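(* Let $n\ge 1$ and let $U$ be any Clifford circuit on $n$ data qubits $\mathrm{Q}_1,\dots,\mathrm{Q}_n$. By introducing $n$ auxiliary qubits $\mathrm{A}_1,\dots,\mathrm{A}_n$ and preparing five $4n$-qubit stabilizer states and eight $2n$-qubit stabilizer states, which are used as ancillas for the Pauli measurement steps, $U$ can be implemented on the data qubits, up to a permutation of qubits (and up to a Pauli correction determined by the measurement outcomes), by $22$ steps of Pauli measurements on the $2n$ qubits $\mathrm{A}_1,\dots,\mathrm{A}_n,\mathrm{Q}_1,\dots,\mathrm{Q}_n$.
   Context: A Clifford circuit is a unitary circuit composed of Hadamard gates, Phase gates $\mathrm{P}=\mathrm{diag}(1,i)$ and CNOT gates. A stabilizer state on $m$ qubits is a joint $+1$ eigenvector of $m$ independent commuting Pauli operators (generating a group not containing $-I$). Setting. There are $N=2n$ working qubits in the order $\mathrm{A}_1,\dots,\mathrm{A}_n,\mathrm{Q}_1,\dots,\mathrm{Q}_n$. The data qubits start in an arbitrary unknown state $|\psi\rangle$ and the auxiliary qubits start in $|0\rangle^{\otimes n}$ or $|+\rangle^{\otimes n}$. Step of Pauli measurement. One step is the simultaneous measurement of a set of pairwise commuting Hermitian Pauli operators on the $2n$ working qubits. If all operators in the set are single-qubit Pauli operators, the step can be performed by direct single-qubit measurement, without any ancilla state. Otherwise the step consumes one ancilla state $|\Omega\rangle$ in one of the following ways. (i) $|\Omega\rangle$ is a $4n$-qubit state on two blocks of $2n$ qubits. A transversal CNOT is applied between the working qubits and the second block (for each $j$, control is the $j$th working qubit and target is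 the $j$th qubit of the second block), and a transversal CNOT is applied between the first block and the working qubits (control is the $j$th qubit of the first block and target is the $j$th working qubit). Then all qubits of the first block are measured in the $X$ basis and all qubits of the second block in the $Z$ basis. (ii) $|\Omega\rangle$ is a $2n$-qubit state playing the role of only the first block, or of only the second block, in (i), the other block and its CNOTs being omitted. The step measures the operators $G_1,\dots,G_d$ if, for every bit string of ancilla measurement outcomes, the resulting operation on the working qubits is proportional to the projector $\prod_{i=1}^d \tfrac12(I+(-1)^{s_i}G_i)$, with signs $s_i\in\{0,1\}$ determined by the bit string. Conventions. Pauli gates on the working qubits, possibly conditioned on earlier measurement outcomes, are free and not counted as steps. No other operations on the working qubits are used. Permutations of qubits are merely recorded in software. "Implemented up to a permutation of qubits" means: there is a fixed permutation of the $2n$ working qubits such that for every $|\psi\rangle$ and every sequence of measurement outcomes, after applying the permutation, the final state of the working qubits is, up to a global phase, $|\alpha\rangle_{\mathrm{A}}\otimes E\,U|\psi\rangle_{\mathrm{Q}}$, where the Pauli operator $E$ and the auxiliary state $|\alpha\rangle$ depend only on the outcomes and not on $|\psi\rangle$. *)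

theory Defs
  imports "HOL-Analysis.Analysis"
begin

text \<open>
  Qubits are labelled by the elements of a finite type; a computational basis state of a register
  is a bit assignment, with \<open>False\<close> for \<open>|0>\<close> and \<open>True\<close> for \<open>|1>\<close>. The entry
  \<open>M $ x $ y\<close> of an operator is \<open><x|M|y>\<close>. A sum of label types is the juxtaposition of
  two registers.
\<close>

type_synonym 'q ket = "complex ^ ('q \<Rightarrow> bool)"
type_synonym 'q qop = "complex ^ ('q \<Rightarrow> bool) ^ ('q \<Rightarrow> bool)"

definition tensor :: "'a::finite ket \<Rightarrow> 'b::finite ket \<Rightarrow> ('a + 'b) ket" where
  "tensor u v = (\<chi> x. u $ (x \<circ> Inl) * v $ (x \<circ> Inr))"

definition product_ket :: "('q::finite \<Rightarrow> complex ^ bool) \<Rightarrow> 'q ket" where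
  "product_ket f = (\<chi> x. \<Prod>q\<in>UNIV. f q $ x q)"

text \<open>\<open>(<a| \<otimes> I)|\<Psi>>\<close>: the unnormalised state left on the second register.\<close>

definition contract :: "'a::finite ket \<Rightarrow> ('a + 'b::finite) ket \<Rightarrow> 'b ket" where
  "contract a \<Psi> = (\<chi> y. \<Sum>x\<in>UNIV. cnj (a $ x) * \<Psi> $ case_sum x y)"

text \<open>Qubit \<open>q\<close> is moved to position \<open>\<pi> q\<close>.\<close>

definition permute_qubits :: "('q::finite \<Rightarrow> 'q) \<Rightarrow> 'q ket \<Rightarrow> 'q ket" where
  "permute_qubits \<pi> \<phi> = (\<chi> x. \<phi> $ (x \<circ> \<pi>))"

definition z_basis :: "bool \<Rightarrow> complex ^ bool" where
  "z_basis b = (\<chi> a. if a = b then 1 else 0)"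

definition x_basis :: "bool \<Rightarrow> complex ^ bool" where
  "x_basis b = (\<chi> a. (if a \<and> b then -1 else 1) / complex_of_real (sqrt 2))"

definition z_ket :: "('q::finite \<Rightarrow> bool) \<Rightarrow> 'q ket" where
  "z_ket v = product_ket (\<lambda>q. z_basis (v q))"

definition x_ket :: "('q::finite \<Rightarrow> bool) \<Rightarrow> 'q ket" where
  "x_ket u = product_ket (\<lambda>q. x_basis (u q))"


section \<open>Clifford circuits\<close>

definition on_qubit :: "'q::finite \<Rightarrow> complex ^ bool ^ bool \<Rightarrow> 'q qop" where
  "on_qubit q M = (\<chi> x y. if \<forall>r. r \<noteq> q \<longrightarrow> x r = y r then M $ x q $ y q else 0)"

definition hadamard :: "complex ^ bool ^ bool" where
  "hadamard = (\<chi> a b. (if a \<and> b then -1 else 1) / complex_of_real (sqrt 2))"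

definition phase_gate :: "complex ^ bool ^ bool" where
  "phase_gate = (\<chi> a b. if a = b then (if a then \<i> else 1) else 0)"

definition cnot :: "'q::finite \<Rightarrow> 'q \<Rightarrow> 'q qop" where
  "cnot c t = (\<chi> x y. if x = y(t := (y t \<noteq> y c)) then 1 else 0)"

inductive clifford_circuit :: "'q::finite qop \<Rightarrow> bool" where
  empty: "clifford_circuit (mat 1)"
| hadamard: "clifford_circuit U \<Longrightarrow> clifford_circuit (on_qubit q hadamard ** U)"
| phase: "clifford_circuit U \<Longrightarrow> clifford_circuit (on_qubit q phase_gate ** U)"
| cnot: "clifford_circuit U \<Longrightarrow> c \<noteq> t \<Longrightarrow> clifford_circuit (cnot c t ** U)"


section \<open>Pauli operators and stabilizer states\<close>

datatype pauli = PI | PX | PY | PZ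

fun pauli_mat :: "pauli \<Rightarrow> complex ^ bool ^ bool" where
  "pauli_mat PI = (\<chi> a b. if a = b then 1 else 0)"
| "pauli_mat PX = (\<chi> a b. if a = b then 0 else 1)"
| "pauli_mat PY = (\<chi> a b. if a = b then 0 else if a then \<i> else - \<i>)"
| "pauli_mat PZ = (\<chi> a b. if a = b then (if a then -1 else 1) else 0)"

definition pauli_string :: "('q::finite \<Rightarrow> pauli) \<Rightarrow> 'q qop" where
  "pauli_string p = (\<chi> x y. \<Prod>q\<in>UNIV. pauli_mat (p q) $ x q $ y q)"

definition hermitian_pauli :: "'q::finite qop \<Rightarrow> bool" where
  "hermitian_pauli G \<longleftrightarrow> (\<exists>p. G = pauli_string p \<or> G = - pauli_string p)"

definition single_qubit_pauli :: "'q::finite qop \<Rightarrow> bool" where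
  "single_qubit_pauli G \<longleftrightarrow>
     (\<exists>q P. P \<noteq> PI \<and>
        (G = pauli_string ((\<lambda>_. PI)(q := P)) \<or> G = - pauli_string ((\<lambda>_. PI)(q := P))))"

text \<open>
  Closure under products is the generated group for sets of Hermitian Pauli operators, because
  these are involutions.
\<close>

inductive_set generated :: "'q::finite qop set \<Rightarrow> 'q qop set" for S where
  one: "mat 1 \<in> generated S"
| mult: "G \<in> S \<Longrightarrow> M \<in> generated S \<Longrightarrow> G ** M \<in> generated S"

text \<open>
  Restricting the generators to Hermitian Pauli operators loses nothing: a Pauli operator with
  phase \<open>i\<close> or \<open>-i\<close> squares to \<open>-I\<close>.
\<close>

definition stabilizer_state :: "'q::finite ket \<Rightarrow> bool" where
  "stabilizer_state \<Omega> \<longleftrightarrow> norm \<Omega> = 1 \<and>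
     (\<exists>S. finite S \<and> card S = CARD('q) \<and>
        (\<forall>G\<in>S. hermitian_pauli G) \<and>
        (\<forall>G\<in>S. \<forall>H\<in>S. G ** H = H ** G) \<and>
        (\<forall>G\<in>S. G \<notin> generated (S - {G})) \<and>
        - mat 1 \<notin> generated S \<and>
        (\<forall>G\<in>S. G *v \<Omega> = \<Omega>))"


section \<open>Steps of Pauli measurement\<close>

text \<open>
  Simultaneous CNOT gates with controls \<open>c j\<close> and targets \<open>t j\<close>; the lemma identifies it
  with the product of the individual gates.
\<close>

definition transversal_cnot :: "('j \<Rightarrow> 'q::finite) \<Rightarrow> ('j \<Rightarrow> 'q) \<Rightarrow> 'q qop" where
  "transversal_cnot c t =
     (\<chi> x y. if x = (\<lambda>q. y q \<noteq> (\<exists>j. q = t j \<and> y (c j))) then 1 else 0)"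

lemma transversal_cnot_eq_product:
  fixes c t :: "'j \<Rightarrow> 'q::finite"
  assumes "inj t" and "range c \<inter> range t = {}" and "distinct js" and "set js = UNIV"
  shows "transversal_cnot c t = foldr (\<lambda>j M. cnot (c j) (t j) ** M) js (mat 1)"
proof -
  let ?B = "\<lambda>f. (\<chi> x y. if x = f y then 1 else 0) :: 'q qop"
  have mult: "?B f ** ?B g = ?B (\<lambda>y. f (g y))" for f g :: "('q \<Rightarrow> bool) \<Rightarrow> 'q \<Rightarrow> bool"
  proof -
    have "(\<Sum>k\<in>UNIV. (if x = f k then 1 else 0) * (if k = g y then 1 else 0)) =
        (if x = f (g y) then 1 else (0 :: complex))" for x y
      by (subst sum.mono_neutral_right[of UNIV "{g y}"]) auto
    then show ?thesis by (simp add: matrix_matrix_mult_def vec_eq_iff)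
  qed
  have "foldr (\<lambda>j M. cnot (c j) (t j) ** M) js (mat 1) =
      ?B (\<lambda>y q. y q \<noteq> (\<exists>j\<in>set js. q = t j \<and> y (c j)))"
    using assms(3)
  proof (induction js)
    case Nil
    show ?case by (simp add: mat_def vec_eq_iff)
  next
    case (Cons i js)
    let ?f = "\<lambda>y q. y q \<noteq> (\<exists>j\<in>set js. q = t j \<and> y (c j))"
    let ?g = "\<lambda>y q. y q \<noteq> (\<exists>j\<in>set (i # js). q = t j \<and> y (c j))"
    have eq: "(?f y)(t i := (?f y (t i) \<noteq> ?f y (c i))) = ?g y" for y
    proof
      fix q
      have "c i \<noteq> t j" for j using assms(2) by blast
      moreover have "t i = t j \<longleftrightarrow> i = j" for j using assms(1) by (auto dest: injD)
      ultimately show "((?f y)(t i := (?f y (t i) \<noteq> ?f y (c i)))) q = ?g y q"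
        using Cons.prems by auto
    qed
    have "foldr (\<lambda>j M. cnot (c j) (t j) ** M) (i # js) (mat 1) =
        ?B (\<lambda>y. y(t i := (y (t i) \<noteq> y (c i)))) ** ?B ?f"
      using Cons by (simp add: cnot_def)
    also have "\<dots> = ?B ?g" by (simp only: mult eq)
    finally show ?case .
  qed
  then show ?thesis using assms(4) by (simp add: transversal_cnot_def)
qed

text \<open>
  The list is the set of operators measured in the step. \<open>Two_Block\<close> carries an ancilla state on
  first block \<open>+\<close> second block; the other two constructors carry a one-block ancilla state playing
  the role of the first, respectively second, block.
\<close>

datatype 'q step =
  Direct "'q::finite qop list"
| Two_Block "'q qop list" "('q + 'q) ket"
| First_Block "'q qop list" "'q ket"
| Second_Block "'q qop list" "'q ket"

fun measured :: "'q::finite step \<Rightarrow> 'q qop list" where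
  "measured (Direct Gs) = Gs"
| "measured (Two_Block Gs \<Omega>) = Gs"
| "measured (First_Block Gs \<Omega>) = Gs"
| "measured (Second_Block Gs \<Omega>) = Gs"

fun uses_two_blocks :: "'q::finite step \<Rightarrow> bool" where
  "uses_two_blocks (Two_Block Gs \<Omega>) = True"
| "uses_two_blocks _ = False"

fun uses_one_block :: "'q::finite step \<Rightarrow> bool" where
  "uses_one_block (First_Block Gs \<Omega>) = True"
| "uses_one_block (Second_Block Gs \<Omega>) = True"
| "uses_one_block _ = False"

text \<open>
  \<open>Signs\<close>: outcomes of direct measurements, one per operator (\<open>True\<close> for eigenvalue \<open>-1\<close>).
  The other constructors hold the outcomes of the \<open>X\<close> basis measurements of the first block and
  the \<open>Z\<close> basis measurements of the second block.
\<close>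

datatype 'q outcome =
  Signs "bool list"
| XZ_Bits "'q \<Rightarrow> bool" "'q \<Rightarrow> bool"
| X_Bits "'q \<Rightarrow> bool"
| Z_Bits "'q \<Rightarrow> bool"

fun outcomes :: "'q::finite step \<Rightarrow> 'q outcome set" where
  "outcomes (Direct Gs) = {Signs s | s. length s = length Gs}"
| "outcomes (Two_Block Gs \<Omega>) = {XZ_Bits u v | u v. True}"
| "outcomes (First_Block Gs \<Omega>) = range X_Bits"
| "outcomes (Second_Block Gs \<Omega>) = range Z_Bits"

fun signed_projector :: "('q::finite qop \<times> bool) list \<Rightarrow> 'q qop" where
  "signed_projector [] = mat 1"
| "signed_projector ((G, s) # Gs) =
     ((1/2) *\<^sub>R (mat 1 + (if s then - G else G))) ** signed_projector Gs"

text \<open>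
  The unnormalised state of the working qubits after a step with a given outcome; its squared
  norm is the probability of the outcome.
\<close>

fun after_step :: "'q::finite step \<Rightarrow> 'q outcome \<Rightarrow> 'q ket \<Rightarrow> 'q ket" where
  "after_step (Direct Gs) (Signs s) \<phi> = signed_projector (zip Gs s) *v \<phi>"
| "after_step (Two_Block Gs \<Omega>) (XZ_Bits u v) \<phi> =
     contract (tensor (x_ket u) (z_ket v))
       (transversal_cnot (\<lambda>j. Inl (Inl j)) Inr *v
         (transversal_cnot Inr (\<lambda>j. Inl (Inr j)) *v tensor \<Omega> \<phi>))"
| "after_step (First_Block Gs \<Omega>) (X_Bits u) \<phi> =
     contract (x_ket u) (transversal_cnot Inl Inr *v tensor \<Omega> \<phi>)"
| "after_step (Second_Block Gs \<Omega>) (Z_Bits v) \<phi> =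
     contract (z_ket v) (transversal_cnot Inr Inl *v tensor \<Omega> \<phi>)"
| "after_step _ _ \<phi> = 0"

definition measures_correctly :: "'q::finite step \<Rightarrow> bool" where
  "measures_correctly S \<longleftrightarrow>
     (\<forall>b\<in>outcomes S. \<exists>s c. length s = length (measured S) \<and> c \<noteq> 0 \<and>
        (\<forall>\<phi>. after_step S b \<phi> = c *s (signed_projector (zip (measured S) s) *v \<phi>)))"

fun admissible_resource :: "'q::finite step \<Rightarrow> bool" where
  "admissible_resource (Direct Gs) \<longleftrightarrow> (\<forall>G\<in>set Gs. single_qubit_pauli G)"
| "admissible_resource (Two_Block Gs \<Omega>) \<longleftrightarrow> stabilizer_state \<Omega>"
| "admissible_resource (First_Block Gs \<Omega>) \<longleftrightarrow> stabilizer_state \<Omega>"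
| "admissible_resource (Second_Block Gs \<Omega>) \<longleftrightarrow> stabilizer_state \<Omega>"

definition pauli_measurement_step :: "'q::finite step \<Rightarrow> bool" where
  "pauli_measurement_step S \<longleftrightarrow>
     (\<forall>G\<in>set (measured S). hermitian_pauli G) \<and>
     (\<forall>G\<in>set (measured S). \<forall>H\<in>set (measured S). G ** H = H ** G) \<and>
     admissible_resource S \<and> measures_correctly S"


section \<open>Protocols\<close>

text \<open>
  \<open>corr h\<close> is the Pauli gate applied once the outcomes \<open>h\<close> (in chronological order) have been
  obtained, i.e. before the next step, or after the last one.
\<close>

fun run :: "('q::finite outcome list \<Rightarrow> 'q \<Rightarrow> pauli) \<Rightarrow> 'q outcome list \<Rightarrow>
    ('q step \<times> 'q outcome) list \<Rightarrow> 'q ket \<Rightarrow> 'q ket" where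
  "run corr h [] \<phi> = pauli_string (corr h) *v \<phi>"
| "run corr h ((S, b) # xs) \<phi> =
     run corr (h @ [b]) xs (after_step S b (pauli_string (corr h) *v \<phi>))"

text \<open>
  In the working register \<open>'n + 'n\<close> the left summand holds the auxiliary qubits and the right
  summand the data qubits. Outcome sequences with \<open>\<phi> = 0\<close> have probability zero.
\<close>

definition implements_up_to_permutation ::
  "'n::finite ket \<Rightarrow> ('n + 'n) step list \<Rightarrow>
   (('n + 'n) outcome list \<Rightarrow> 'n + 'n \<Rightarrow> pauli) \<Rightarrow> 'n qop \<Rightarrow> bool" where
  "implements_up_to_permutation aux steps corr U \<longleftrightarrow>
     (\<exists>\<pi>. bij \<pi> \<and>
       (\<forall>bs. list_all2 (\<lambda>b S. b \<in> outcomes S) bs steps \<longrightarrow>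
         (\<exists>\<alpha> E. norm \<alpha> = 1 \<and>
           (\<forall>\<psi>. norm \<psi> = 1 \<longrightarrow>
             (let \<phi> = run corr [] (zip steps bs) (tensor aux \<psi>) in
              \<phi> \<noteq> 0 \<longrightarrow>
              (\<exists>c. cmod c = 1 \<and>
                permute_qubits \<pi> ((1 / norm \<phi>) *\<^sub>R \<phi>) =
                  c *s tensor \<alpha> (pauli_string E *v (U *v \<psi>))))))))"

end

theory Submission
  imports Defs
begin

text \<open>
  Three two-block steps suffice; the other nineteen measure the empty set of operators.
  The first step measures \<open>X\<close> on all auxiliary qubits, the second one
  \<open>Z \<otimes> U\<^sup>*ZU\<close> on each pair of an auxiliary qubit and a data qubit, and the third one
  \<open>U\<^sup>*XU\<close> for each data qubit. As in one-bit teleportation this moves \<open>U|\<psi>>\<close>, up to a Pauli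
  operator, to the auxiliary qubits and leaves the data qubits in a state independent of
  \<open>|\<psi>>\<close>; the permutation swaps the two halves.

  Each of these steps measures the operators \<open>W\<^sup>*Z\<^sub>qW\<close> for \<open>q\<close> in a set and a Clifford operator \<open>W\<close>. With an
  ancilla \<open>\<Omega>\<close> whose amplitude at \<open>(a, b)\<close> is proportional to the entry of an operator \<open>M\<close> at row
  \<open>a + b\<close> and column \<open>b\<close>, a two-block step applies \<open>M\<close> conjugated by the Pauli operator of the
  outcomes. If \<open>M\<close> is a joint eigenprojector of Pauli operators, this conjugation only changes signs. For
  the projector at hand \<open>\<Omega>\<close> is obtained from a product of states \<open>|0>\<close> and \<open>|+>\<close> by Clifford operators,
  so it is a stabilizer state.
\<close>

section \<open>Matrices indexed by bit assignments\<close>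

definition adj :: "complex ^ 'a ^ 'a \<Rightarrow> complex ^ 'a ^ 'a" where
  "adj M = (\<chi> x y. cnj (M $ y $ x))"

lemma adj_nth [simp]: "adj M $ x $ y = cnj (M $ y $ x)"
  by (simp add: adj_def)

lemma adj_adj [simp]: "adj (adj M) = M"
  by (simp add: vec_eq_iff)

lemma adj_mat_1 [simp]: "adj (mat 1) = mat 1"
  by (auto simp: vec_eq_iff mat_def)

lemma adj_mult: "adj (A ** B) = adj B ** adj A"
  by (simp add: vec_eq_iff matrix_matrix_mult_def mult.commute)

lemma matrix_mult_uminus_left [simp]: "(- A :: complex ^ 'a ^ 'a) ** B = - (A ** B)"
  by (simp add: vec_eq_iff matrix_matrix_mult_def sum_negf)

lemma matrix_mult_uminus_right [simp]: "A ** (- B :: complex ^ 'a ^ 'a) = - (A ** B)"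
  by (simp add: vec_eq_iff matrix_matrix_mult_def sum_negf)

lemma matrix_mult_add_left: "(A + B :: complex ^ 'a ^ 'a) ** C = A ** C + B ** C"
  by (simp add: vec_eq_iff matrix_matrix_mult_def sum.distrib distrib_right)

lemma matrix_mult_scaleR:
  "(r *\<^sub>R A :: complex ^ 'a ^ 'a) ** B = r *\<^sub>R (A ** B)"
  "A ** (r *\<^sub>R B :: complex ^ 'a ^ 'a) = r *\<^sub>R (A ** B)"
  by (simp_all add: vec_eq_iff matrix_matrix_mult_def scaleR_sum_right)

text \<open>The projector onto the span of the computational basis states that satisfy
  \<open>P\<close>.\<close>

definition diag :: "(('q \<Rightarrow> bool) \<Rightarrow> bool) \<Rightarrow> 'q::finite qop" where
  "diag P = (\<chi> x y. if x = y \<and> P x then 1 else 0)"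

lemma diag_mult_nth: "(diag P ** A) $ x $ y = (if P x then A $ x $ y else 0)"
proof -
  have "(diag P ** A) $ x $ y = (\<Sum>k\<in>UNIV. if k = x then (if P x then A $ x $ y else 0) else 0)"
    unfolding matrix_matrix_mult_def diag_def vec_lambda_beta by (rule sum.cong) auto
  then show ?thesis by simp
qed

lemma diag_mult_vec_nth: "(diag P *v \<phi>) $ x = (if P x then \<phi> $ x else 0)"
proof -
  have "(diag P *v \<phi>) $ x = (\<Sum>k\<in>UNIV. if k = x then (if P x then \<phi> $ x else 0) else 0)"
    unfolding matrix_vector_mult_def diag_def vec_lambda_beta by (rule sum.cong) auto
  then show ?thesis by simp
qed

lemma diag_mult_diag: "diag P ** diag Q = diag (\<lambda>x. P x \<and> Q x)"
  by (simp add: vec_eq_iff diag_mult_nth) (simp add: diag_def)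

definition unitary :: "complex ^ 'a ^ 'a \<Rightarrow> bool" where
  "unitary W \<longleftrightarrow> adj W ** W = mat 1 \<and> W ** adj W = mat 1"

lemma unitary_mult: "unitary A \<Longrightarrow> unitary B \<Longrightarrow> unitary (A ** B)"
  unfolding unitary_def adj_mult
  by (metis matrix_mul_assoc matrix_mul_rid)

lemma unitary_adj: "unitary A \<Longrightarrow> unitary (adj A)"
  by (simp add: unitary_def)

lemma complex_norm_vec_squared:
  fixes v :: "'q::finite ket"
  shows "complex_of_real ((norm v)\<^sup>2) = (\<Sum>x\<in>UNIV. cnj (v $ x) * v $ x)"
proof -
  have "(norm v)\<^sup>2 = (\<Sum>x\<in>UNIV. (cmod (v $ x))\<^sup>2)"
    by (simp add: norm_vec_def L2_set_def sum_nonneg)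
  then show ?thesis
    by (simp only: of_real_sum complex_norm_square mult.commute)
qed

lemma norm_eqI:
  fixes v :: "'q::finite ket" and w :: "'r::finite ket"
  assumes "(\<Sum>x\<in>UNIV. cnj (v $ x) * v $ x) = (\<Sum>x\<in>UNIV. cnj (w $ x) * w $ x)"
  shows "norm v = norm w"
  using assms by (simp only: complex_norm_vec_squared[symmetric] of_real_eq_iff power2_eq_iff_nonneg norm_ge_zero)

lemma norm_smult: "norm (c *s v) = cmod c * norm v" for v :: "'q::finite ket"
  by (simp add: norm_vec_def norm_mult L2_set_right_distrib)

lemma norm_axis_1: "norm (axis a 1 :: 'q::finite ket) = 1"
proof -
  have "complex_of_real ((norm (axis a 1 :: 'q ket))\<^sup>2) = (\<Sum>x\<in>UNIV. if x = a then 1 else 0)"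
    unfolding complex_norm_vec_squared by (rule sum.cong) (auto simp: axis_def)
  also have "\<dots> = 1" by simp
  finally have "(norm (axis a 1 :: 'q ket))\<^sup>2 = 1\<^sup>2" by (simp only: of_real_eq_1_iff power_one)
  then show ?thesis by (simp only: power2_eq_iff_nonneg norm_ge_zero zero_le_one)
qed

lemma norm_unitary:
  fixes W :: "'q::finite qop"
  assumes "unitary W"
  shows "norm (W *v \<phi>) = norm \<phi>"
proof (rule norm_eqI)
  have cnj_nth: "cnj ((W *v \<phi>) $ x) = (\<Sum>y\<in>UNIV. cnj (\<phi> $ y) * cnj (W $ x $ y))" for x
    by (simp add: matrix_vector_mult_def mult.commute)
  have "(\<Sum>x\<in>UNIV. cnj ((W *v \<phi>) $ x) * (W *v \<phi>) $ x) =
      (\<Sum>x\<in>UNIV. \<Sum>y\<in>UNIV. cnj (\<phi> $ y) * (cnj (W $ x $ y) * (W *v \<phi>) $ x))"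
    unfolding cnj_nth by (simp only: sum_distrib_right mult.assoc)
  also have "\<dots> = (\<Sum>y\<in>UNIV. cnj (\<phi> $ y) * (adj W *v (W *v \<phi>)) $ y)"
    by (subst sum.swap) (simp add: matrix_vector_mult_def[of "adj W"] sum_distrib_left)
  also have "adj W *v (W *v \<phi>) = \<phi>"
    using assms by (simp add: unitary_def matrix_vector_mul_assoc)
  finally show "(\<Sum>x\<in>UNIV. cnj ((W *v \<phi>) $ x) * (W *v \<phi>) $ x) =
      (\<Sum>x\<in>UNIV. cnj (\<phi> $ x) * \<phi> $ x)" .
qed

section \<open>Tensor products\<close>

text \<open>Restriction to the two summands identifies assignments on the joint register with pairs
  of assignments. The entrywise computations with tensor products rest on this splitting.\<close>

lemma sum_sum_assignment:
  "(\<Sum>x\<in>UNIV. F x) = (\<Sum>a\<in>UNIV. \<Sum>b\<in>UNIV. F (case_sum a b))"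
  for F :: "('a::finite + 'b::finite \<Rightarrow> bool) \<Rightarrow> 'c::comm_monoid_add"
proof -
  have "bij_betw (\<lambda>(a, b). case_sum a b) UNIV (UNIV :: ('a + 'b \<Rightarrow> bool) set)"
    by (rule bij_betw_byWitness[where f' = "\<lambda>x. (x \<circ> Inl, x \<circ> Inr)"])
      (auto simp: fun_eq_iff split: sum.splits)
  from sum.reindex_bij_betw[OF this, of F] show ?thesis
    by (simp add: sum.cartesian_product UNIV_Times_UNIV case_prod_unfold)
qed

lemma case_sum_comp [simp]: "case_sum a b \<circ> Inl = a" "case_sum a b \<circ> Inr = b"
  by auto

lemma tensor_nth [simp]: "tensor u v $ x = u $ (x \<circ> Inl) * v $ (x \<circ> Inr)"
  by (simp add: tensor_def)

lemma norm_tensor: "norm (tensor u v) = norm u * norm v"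
proof -
  have "complex_of_real ((norm (tensor u v))\<^sup>2) = complex_of_real ((norm u)\<^sup>2 * (norm v)\<^sup>2)"
    unfolding of_real_mult complex_norm_vec_squared sum_sum_assignment sum_product
    by (simp add: mult_ac)
  then have "(norm (tensor u v))\<^sup>2 = (norm u * norm v)\<^sup>2"
    by (simp only: of_real_eq_iff power_mult_distrib)
  then show ?thesis by (simp add: power2_eq_iff_nonneg)
qed

section \<open>Tensor products of operators\<close>

definition kron :: "'a::finite qop \<Rightarrow> 'b::finite qop \<Rightarrow> ('a + 'b) qop" where
  "kron A B = (\<chi> x y. A $ (x \<circ> Inl) $ (y \<circ> Inl) * B $ (x \<circ> Inr) $ (y \<circ> Inr))"

lemma kron_nth [simp]:
  "kron A B $ x $ y = A $ (x \<circ> Inl) $ (y \<circ> Inl) * B $ (x \<circ> Inr) $ (y \<circ> Inr)"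
  by (simp add: kron_def)

lemma kron_mult: "kron A B ** kron C D = kron (A ** C) (B ** D)"
  by (simp add: vec_eq_iff matrix_matrix_mult_def sum_sum_assignment sum_product mult_ac)

lemma kron_mult_vec: "kron A B *v tensor u v = tensor (A *v u) (B *v v)"
  by (simp add: vec_eq_iff matrix_vector_mult_def sum_sum_assignment sum_product mult_ac)

lemma kron_mat_1 [simp]: "kron (mat 1) (mat 1) = mat 1"
proof -
  have "x = y \<longleftrightarrow> x \<circ> Inl = y \<circ> Inl \<and> x \<circ> Inr = y \<circ> Inr" for x y :: "'a + 'b \<Rightarrow> bool"
    by (metis (no_types, lifting) comp_apply ext sum.exhaust)
  then show ?thesis by (auto simp: vec_eq_iff mat_def)
qed

lemma adj_kron: "adj (kron A B) = kron (adj A) (adj B)"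
  by (simp add: vec_eq_iff)

lemma kron_uminus [simp]: "kron (- A) B = - kron A B" "kron A (- B) = - kron A B"
  by (simp_all add: vec_eq_iff)

lemma unitary_kron: "unitary A \<Longrightarrow> unitary B \<Longrightarrow> unitary (kron A B)"
  by (simp add: unitary_def adj_kron kron_mult)

text \<open>The tensor product of one single-qubit operator per label. Pauli strings and
  single-qubit gates are instances, so their algebra reduces to that of 2 x 2 matrices.\<close>

definition prod_op :: "('q::finite \<Rightarrow> complex ^ bool ^ bool) \<Rightarrow> 'q qop" where
  "prod_op f = (\<chi> x y. \<Prod>q\<in>UNIV. f q $ x q $ y q)"

lemma prod_op_nth: "prod_op f $ x $ y = (\<Prod>q\<in>UNIV. f q $ x q $ y q)"
  by (simp add: prod_op_def)

text \<open>Distributivity: a sum over all bit assignments of a product over qubits equals the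
  product over qubits of sums over a single bit.\<close>

lemma prod_op_mult: "prod_op f ** prod_op g = prod_op (\<lambda>q. f q ** g q)"
proof -
  have "(\<Sum>z\<in>UNIV. (\<Prod>q\<in>UNIV. f q $ x q $ z q) * (\<Prod>q\<in>UNIV. g q $ z q $ y q)) =
      (\<Prod>q\<in>UNIV. \<Sum>b\<in>UNIV. f q $ x q $ b * g q $ b $ y q)" for x y
    by (subst prod_sum_PiE) (auto simp: prod.distrib)
  then show ?thesis
    by (simp add: vec_eq_iff matrix_matrix_mult_def prod_op_nth)
qed

lemma prod_indicator:
  "(\<Prod>q\<in>UNIV. if P q then 1 else 0) = (if \<forall>q. P q then 1 else (0 :: complex))"
  for P :: "'q::finite \<Rightarrow> bool"
  by auto

lemma prod_op_mat_1: "prod_op (\<lambda>_. mat 1) = mat 1"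
  by (simp add: vec_eq_iff prod_op_nth mat_def prod_indicator fun_eq_iff)

lemma pauli_string_eq_prod_op: "pauli_string p = prod_op (\<lambda>q. pauli_mat (p q))"
  by (simp add: pauli_string_def prod_op_def)

lemma on_qubit_eq_prod_op: "on_qubit q M = prod_op ((\<lambda>_. mat 1)(q := M))"
proof -
  have "(\<Prod>r\<in>UNIV. ((\<lambda>_. mat 1)(q := M)) r $ x r $ y r) =
      M $ x q $ y q * (\<Prod>r\<in>UNIV - {q}. if x r = y r then 1 else 0)" for x y
    by (subst prod.remove[of _ q]) (auto simp: mat_def intro!: prod.cong)
  then show ?thesis
    by (auto simp: vec_eq_iff on_qubit_def prod_op_nth)
qed


section \<open>Clifford operators\<close>

lemma prod_op_adj: "adj (prod_op f) = prod_op (\<lambda>q. adj (f q))"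
  by (simp add: vec_eq_iff prod_op_nth)

lemma prod_op_mult_vec: "prod_op f *v product_ket g = product_ket (\<lambda>q. f q *v g q)"
proof -
  have "(\<Sum>z\<in>UNIV. (\<Prod>q\<in>UNIV. f q $ x q $ z q) * (\<Prod>q\<in>UNIV. g q $ z q)) =
      (\<Prod>q\<in>UNIV. \<Sum>b\<in>UNIV. f q $ x q $ b * g q $ b)" for x
    by (subst prod_sum_PiE) (auto simp: prod.distrib)
  then show ?thesis
    by (simp add: vec_eq_iff matrix_vector_mult_def prod_op_nth product_ket_def)
qed

lemma norm_product_ket:
  assumes "\<And>q. norm (g q) = 1"
  shows "norm (product_ket g) = 1"
proof -
  have "complex_of_real ((norm (product_ket g))\<^sup>2) =
      (\<Sum>x\<in>UNIV. \<Prod>q\<in>UNIV. cnj (g q $ x q) * g q $ x q)"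
    by (simp add: complex_norm_vec_squared product_ket_def prod.distrib del: of_real_power)
  also have "\<dots> = (\<Prod>q\<in>UNIV. \<Sum>b\<in>UNIV. cnj (g q $ b) * g q $ b)"
    by (subst prod_sum_PiE) auto
  also have "\<dots> = (\<Prod>q\<in>UNIV. complex_of_real ((norm (g q))\<^sup>2))"
    by (rule prod.cong[OF refl]) (simp add: UNIV_bool norm_vec_def L2_set_def complex_norm_square[symmetric]
        mult.commute[of "cnj _"])
  also have "\<dots> = 1" using assms by simp
  finally have "(norm (product_ket g))\<^sup>2 = 1" by (simp only: of_real_eq_1_iff)
  then show ?thesis by (simp add: power2_eq_1_iff) (smt (verit) norm_ge_zero)
qed

definition signed_pauli :: "complex ^ bool ^ bool \<Rightarrow> bool" where
  "signed_pauli M \<longleftrightarrow> (\<exists>P. M = pauli_mat P \<or> M = - pauli_mat P)"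

lemma pauli_mat_PI: "pauli_mat PI = mat 1"
  by (simp add: vec_eq_iff mat_def)

lemma hermitian_pauli_uminus [simp]: "hermitian_pauli (- G) \<longleftrightarrow> hermitian_pauli G"
  unfolding hermitian_pauli_def by (metis minus_minus)

lemma hermitian_pauli_string [simp]: "hermitian_pauli (pauli_string p)"
  unfolding hermitian_pauli_def by blast

lemma prod_signs: "(\<Prod>q\<in>A. if e q then -1 else 1) \<in> {1, -1 :: complex}"
  by (induction A rule: infinite_finite_induct) auto

text \<open>The signs of the factors multiply to one global sign, which is again 1 or -1.\<close>

lemma hermitian_pauli_prod_op:
  assumes "\<And>q. signed_pauli (f q)"
  shows "hermitian_pauli (prod_op f)"
proof -
  have "\<forall>q. \<exists>P e. f q = (if e then - pauli_mat P else pauli_mat P)"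
    using assms unfolding signed_pauli_def by (metis (full_types))
  then obtain p e where f: "\<And>q. f q = (if e q then - pauli_mat (p q) else pauli_mat (p q))"
    by metis
  have "f q $ a $ b = (if e q then -1 else 1) * pauli_mat (p q) $ a $ b" for q a b
    by (simp add: f)
  then have "prod_op f $ x $ y = (\<Prod>q\<in>UNIV. if e q then -1 else 1) * pauli_string p $ x $ y" for x y
    by (simp add: prod_op_nth pauli_string_def prod.distrib)
  then show ?thesis
    using prod_signs[of e UNIV] unfolding hermitian_pauli_def
    by (auto simp: vec_eq_iff)
qed

lemma unitary_pauli_string: "unitary (pauli_string p)"
proof -
  have adj: "adj (pauli_mat P) = pauli_mat P" for P
    by (cases P) (auto simp: vec_eq_iff)
  have "pauli_mat P ** pauli_mat P = mat 1" for P
    by (cases P) (simp_all add: vec_eq_iff matrix_matrix_mult_def UNIV_bool all_bool_eq mat_def)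
  then show ?thesis
    by (simp add: unitary_def pauli_string_eq_prod_op prod_op_adj adj prod_op_mult prod_op_mat_1)
qed

text \<open>The normaliser description of Clifford operators; circuits enter the argument only
  through it. Demanding conjugation in both directions makes closure under adjoints
  immediate.\<close>

definition clifford :: "'q::finite qop \<Rightarrow> bool" where
  "clifford W \<longleftrightarrow> unitary W \<and>
     (\<forall>G. hermitian_pauli G \<longrightarrow> hermitian_pauli (W ** G ** adj W)) \<and>
     (\<forall>G. hermitian_pauli G \<longrightarrow> hermitian_pauli (adj W ** G ** W))"

lemma cliffordI:
  fixes W :: "'a::finite qop"
  assumes "unitary W"
    and "\<And>p. hermitian_pauli (W ** pauli_string p ** adj W)"
    and "\<And>p. hermitian_pauli (adj W ** pauli_string p ** W)"
  shows "clifford W"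
proof -
  have "hermitian_pauli (A ** G ** B)"
    if "\<And>p. hermitian_pauli (A ** pauli_string p ** B)" and "hermitian_pauli G" for A B G :: "'a qop"
    using that(2) unfolding hermitian_pauli_def[of G] by (auto simp: that(1))
  then show ?thesis using assms unfolding clifford_def by blast
qed

lemma clifford_mat_1: "clifford (mat 1)"
  by (simp add: clifford_def unitary_def)

lemma clifford_adj: "clifford W \<Longrightarrow> clifford (adj W)"
  by (simp add: clifford_def unitary_adj)

lemma clifford_mult:
  assumes "clifford A" and "clifford B"
  shows "clifford (A ** B)"
proof -
  have "A ** B ** G ** adj (A ** B) = A ** (B ** G ** adj B) ** adj A"
    "adj (A ** B) ** G ** (A ** B) = adj B ** (adj A ** G ** A) ** B" for G
    by (simp_all add: adj_mult matrix_mul_assoc)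
  then show ?thesis
    using assms by (simp add: clifford_def unitary_mult)
qed

definition single_clifford :: "complex ^ bool ^ bool \<Rightarrow> bool" where
  "single_clifford M \<longleftrightarrow> unitary M \<and>
     (\<forall>P. signed_pauli (M ** pauli_mat P ** adj M) \<and> signed_pauli (adj M ** pauli_mat P ** M))"

lemma clifford_prod_op:
  assumes "\<And>q. single_clifford (f q)"
  shows "clifford (prod_op f)"
proof (rule cliffordI)
  show "unitary (prod_op f)"
    using assms by (simp add: unitary_def prod_op_adj prod_op_mult single_clifford_def prod_op_mat_1)
qed (use assms in \<open>auto simp: pauli_string_eq_prod_op prod_op_adj prod_op_mult single_clifford_def
  intro!: hermitian_pauli_prod_op\<close>)

lemma single_clifford_mat_1: "single_clifford (mat 1)"
  by (auto simp: single_clifford_def unitary_def signed_pauli_def)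

lemma sqrt_2_mult_sqrt_2: "complex_of_real (sqrt 2) * complex_of_real (sqrt 2) = 2"
  by (simp flip: of_real_mult)

lemma single_clifford_hadamard: "single_clifford hadamard"
proof -
  have adj: "adj hadamard = hadamard"
    by (auto simp: vec_eq_iff hadamard_def)
  note calc = vec_eq_iff matrix_matrix_mult_def UNIV_bool all_bool_eq hadamard_def mat_def
    sqrt_2_mult_sqrt_2
  have "hadamard ** hadamard = mat 1"
    by (simp add: calc)
  moreover have "hadamard ** pauli_mat PI ** hadamard = pauli_mat PI"
    "hadamard ** pauli_mat PX ** hadamard = pauli_mat PZ"
    "hadamard ** pauli_mat PY ** hadamard = - pauli_mat PY"
    "hadamard ** pauli_mat PZ ** hadamard = pauli_mat PX"
    by (simp_all add: calc)
  then have "signed_pauli (hadamard ** pauli_mat P ** hadamard)" for P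
    unfolding signed_pauli_def by (cases P) metis+
  ultimately show ?thesis
    by (simp add: single_clifford_def unitary_def adj)
qed

lemma single_clifford_phase_gate: "single_clifford phase_gate"
proof -
  note calc = vec_eq_iff matrix_matrix_mult_def UNIV_bool all_bool_eq phase_gate_def mat_def
  have "phase_gate ** pauli_mat PI ** adj phase_gate = pauli_mat PI"
    "phase_gate ** pauli_mat PX ** adj phase_gate = pauli_mat PY"
    "phase_gate ** pauli_mat PY ** adj phase_gate = - pauli_mat PX"
    "phase_gate ** pauli_mat PZ ** adj phase_gate = pauli_mat PZ"
    "adj phase_gate ** pauli_mat PI ** phase_gate = pauli_mat PI"
    "adj phase_gate ** pauli_mat PX ** phase_gate = - pauli_mat PY"
    "adj phase_gate ** pauli_mat PY ** phase_gate = pauli_mat PX"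
    "adj phase_gate ** pauli_mat PZ ** phase_gate = pauli_mat PZ"
    by (simp_all add: calc)
  then have "signed_pauli (phase_gate ** pauli_mat P ** adj phase_gate)"
    "signed_pauli (adj phase_gate ** pauli_mat P ** phase_gate)" for P
    unfolding signed_pauli_def by (cases P; metis)+
  moreover have "unitary phase_gate"
    by (simp add: unitary_def calc)
  ultimately show ?thesis
    by (simp add: single_clifford_def)
qed

lemma clifford_on_qubit: "single_clifford M \<Longrightarrow> clifford (on_qubit q M)"
  unfolding on_qubit_eq_prod_op
  by (rule clifford_prod_op) (simp add: single_clifford_mat_1)

text \<open>Conjugation of a two-qubit Pauli operator by CNOT, written in entries: \<open>a\<close>,
  \<open>b\<close> are the control bits of row and column, and CNOT shifts the target bits
  \<open>u\<close>, \<open>v\<close> by them. The witnesses are the table of the 16 images.\<close>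

lemma cnot_pauli_mat:
  "\<exists>e P' Q'. e \<in> {1, -1} \<and> (\<forall>a b u v. pauli_mat P $ a $ b * pauli_mat Q $ (u \<noteq> a) $ (v \<noteq> b) =
     e * (pauli_mat P' $ a $ b * pauli_mat Q' $ u $ v))"
proof -
  define P' where "P' = (case (P, Q) of
      (PI, PI) \<Rightarrow> PI | (PI, PX) \<Rightarrow> PI | (PI, PY) \<Rightarrow> PZ | (PI, PZ) \<Rightarrow> PZ
    | (PX, PI) \<Rightarrow> PX | (PX, PX) \<Rightarrow> PX | (PX, PY) \<Rightarrow> PY | (PX, PZ) \<Rightarrow> PY
    | (PY, PI) \<Rightarrow> PY | (PY, PX) \<Rightarrow> PY | (PY, PY) \<Rightarrow> PX | (PY, PZ) \<Rightarrow> PX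
    | (PZ, PI) \<Rightarrow> PZ | (PZ, PX) \<Rightarrow> PZ | (PZ, PY) \<Rightarrow> PI | (PZ, PZ) \<Rightarrow> PI)"
  define Q' where "Q' = (case (P, Q) of
      (PI, PI) \<Rightarrow> PI | (PI, PX) \<Rightarrow> PX | (PI, PY) \<Rightarrow> PY | (PI, PZ) \<Rightarrow> PZ
    | (PX, PI) \<Rightarrow> PX | (PX, PX) \<Rightarrow> PI | (PX, PY) \<Rightarrow> PZ | (PX, PZ) \<Rightarrow> PY
    | (PY, PI) \<Rightarrow> PX | (PY, PX) \<Rightarrow> PI | (PY, PY) \<Rightarrow> PZ | (PY, PZ) \<Rightarrow> PY
    | (PZ, PI) \<Rightarrow> PI | (PZ, PX) \<Rightarrow> PX | (PZ, PY) \<Rightarrow> PY | (PZ, PZ) \<Rightarrow> PZ)"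
  \<comment> \<open>Only X on control with Z on target, and Y on both, pick up a sign; up to it they
    are exchanged by the conjugation.\<close>
  define e :: complex where
    "e = (if (P, Q) \<in> {(PX, PZ), (PY, PY)} then -1 else 1)"
  have "\<forall>a b u v. pauli_mat P $ a $ b * pauli_mat Q $ (u \<noteq> a) $ (v \<noteq> b) =
     e * (pauli_mat P' $ a $ b * pauli_mat Q' $ u $ v)"
    unfolding P'_def Q'_def e_def
    by (cases P; cases Q) (simp_all add: all_bool_eq)
  moreover have "e \<in> {1, -1}" by (simp add: e_def)
  ultimately show ?thesis by blast
qed

lemma cnot_mult_nth: "(cnot c t ** A) $ x $ y = A $ (x(t := (x t \<noteq> x c))) $ y" if "c \<noteq> t"
proof -
  have eq: "x = k(t := (k t \<noteq> k c)) \<longleftrightarrow> k = x(t := (x t \<noteq> x c))" for k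
    using that by (auto simp: fun_eq_iff)
  have "(cnot c t ** A) $ x $ y =
      (\<Sum>k\<in>UNIV. if k = x(t := (x t \<noteq> x c)) then A $ (x(t := (x t \<noteq> x c))) $ y else 0)"
    unfolding matrix_matrix_mult_def cnot_def vec_lambda_beta eq by (rule sum.cong) auto
  then show ?thesis by simp
qed

lemma mult_cnot_nth: "(A ** cnot c t) $ x $ y = A $ x $ (y(t := (y t \<noteq> y c)))"
proof -
  have "(A ** cnot c t) $ x $ y =
      (\<Sum>k\<in>UNIV. if k = y(t := (y t \<noteq> y c)) then A $ x $ (y(t := (y t \<noteq> y c))) else 0)"
    unfolding matrix_matrix_mult_def cnot_def vec_lambda_beta by (rule sum.cong) auto
  then show ?thesis by simp
qed

lemma adj_cnot: "adj (cnot c t) = cnot c t" if "c \<noteq> t"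
  using that by (auto simp: vec_eq_iff cnot_def fun_eq_iff)

lemma clifford_cnot:
  assumes "c \<noteq> t"
  shows "clifford (cnot c t)"
proof -
  have "cnot c t ** cnot c t = mat 1"
    using assms by (simp add: vec_eq_iff cnot_mult_nth) (auto simp: cnot_def mat_def fun_eq_iff)
  then have unitary: "unitary (cnot c t)"
    by (simp add: unitary_def adj_cnot assms)
  have "hermitian_pauli (cnot c t ** pauli_string p ** cnot c t)" for p
  proof -
    obtain e P' Q' where e: "e \<in> {1, -1}" and PQ: "\<And>a b u v.
        pauli_mat (p c) $ a $ b * pauli_mat (p t) $ (u \<noteq> a) $ (v \<noteq> b) =
        e * (pauli_mat P' $ a $ b * pauli_mat Q' $ u $ v)"
      using cnot_pauli_mat[of "p c" "p t"] by blast
    \<comment> \<open>CNOT moves only the bit at \<open>t\<close>, by the bit at \<open>c\<close>.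
      Splitting off these two factors leaves a product that the conjugation does not touch.\<close>
    have split: "pauli_string r $ x $ y = pauli_mat (r c) $ x c $ y c * pauli_mat (r t) $ x t $ y t *
        (\<Prod>q\<in>UNIV - {c, t}. pauli_mat (r q) $ x q $ y q)" for r x y
    proof -
      have "UNIV - {c} - {t} = UNIV - {c, t}" by auto
      then show ?thesis
        using assms unfolding pauli_string_def vec_lambda_beta
        by (simp add: prod.remove[of UNIV c] prod.remove[of "UNIV - {c}" t] mult.assoc)
    qed
    have rest: "(\<Prod>q\<in>UNIV - {c, t}. pauli_mat (p q) $ (x(t := a)) q $ (y(t := b)) q) =
        (\<Prod>q\<in>UNIV - {c, t}. pauli_mat ((p(c := P', t := Q')) q) $ x q $ y q)" for x y a b
      by (rule prod.cong) auto
    have "(cnot c t ** pauli_string p ** cnot c t) $ x $ y =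
        e * pauli_string (p(c := P', t := Q')) $ x $ y" for x y
    proof -
      have "(cnot c t ** pauli_string p ** cnot c t) $ x $ y =
          pauli_string p $ (x(t := (x t \<noteq> x c))) $ (y(t := (y t \<noteq> y c)))"
        by (simp add: mult_cnot_nth cnot_mult_nth assms)
      also have "\<dots> = (pauli_mat (p c) $ x c $ y c * pauli_mat (p t) $ (x t \<noteq> x c) $ (y t \<noteq> y c)) *
          (\<Prod>q\<in>UNIV - {c, t}. pauli_mat ((p(c := P', t := Q')) q) $ x q $ y q)"
        unfolding split[of p] rest using assms by simp
      also have "\<dots> = e * pauli_string (p(c := P', t := Q')) $ x $ y"
        unfolding PQ split[of "p(c := P', t := Q')"] using assms by simp
      finally show ?thesis .
    qed
    then show ?thesis
      using e unfolding hermitian_pauli_def by (auto simp: vec_eq_iff)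
  qed
  with unitary show ?thesis
    by (intro cliffordI) (simp_all add: adj_cnot assms)
qed

lemma clifford_circuit_imp_clifford: "clifford_circuit U \<Longrightarrow> clifford U"
  by (induction rule: clifford_circuit.induct)
    (simp_all add: clifford_mat_1 clifford_mult clifford_on_qubit clifford_cnot
      single_clifford_hadamard single_clifford_phase_gate)

lemma clifford_transversal_cnot:
  fixes c t :: "'j::finite \<Rightarrow> 'q::finite"
  assumes "inj t" and "range c \<inter> range t = {}"
  shows "clifford (transversal_cnot c t)"
proof -
  obtain js :: "'j list" where js: "distinct js" "set js = UNIV"
    using finite_distinct_list[of "UNIV :: 'j set"] by auto
  have "c j \<noteq> t j" for j using assms(2) by blast
  then have "clifford (foldr (\<lambda>j M. cnot (c j) (t j) ** M) js (mat 1))"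
    by (induction js) (simp_all add: clifford_mat_1 clifford_mult clifford_cnot)
  then show ?thesis
    by (simp add: transversal_cnot_eq_product[OF assms js])
qed

section \<open>Closure of Clifford operators under tensor products and transposition\<close>

lemma prod_UNIV_sum:
  "(\<Prod>q\<in>UNIV. h q) = (\<Prod>q\<in>UNIV. h (Inl q)) * (\<Prod>q\<in>UNIV. h (Inr q))"
  for h :: "'a::finite + 'b::finite \<Rightarrow> 'c::comm_monoid_mult"
  by (simp only: UNIV_Plus_UNIV[symmetric] prod.Plus[OF finite finite] comp_def)

lemma pauli_string_sum: "pauli_string p = kron (pauli_string (p \<circ> Inl)) (pauli_string (p \<circ> Inr))"
  by (simp add: vec_eq_iff pauli_string_def prod_UNIV_sum)

lemma hermitian_pauli_kron:
  assumes "hermitian_pauli G" and "hermitian_pauli H"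
  shows "hermitian_pauli (kron G H)"
proof -
  have "kron (pauli_string p) (pauli_string q) = pauli_string (case_sum p q)" for p q
    by (simp add: pauli_string_sum[of "case_sum p q"] comp_def)
  then show ?thesis
    using assms by (auto simp: hermitian_pauli_def)
qed

lemma clifford_kron:
  assumes "clifford A" and "clifford B"
  shows "clifford (kron A B)"
  using assms
  by (intro cliffordI)
    (auto simp: clifford_def unitary_kron adj_kron kron_mult pauli_string_sum[of p for p]
      intro!: hermitian_pauli_kron)

lemma transpose_mult: "transpose (A ** B) = transpose B ** transpose (A :: 'q::finite qop)"
  by (simp add: vec_eq_iff matrix_matrix_mult_def transpose_def mult.commute)

lemma hermitian_pauli_transpose:
  fixes G :: "'a::finite qop"
  assumes "hermitian_pauli G"
  shows "hermitian_pauli (transpose G)"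
proof -
  have "transpose (pauli_mat P) = (if P = PY then - pauli_mat P else pauli_mat P)" for P
    by (cases P) (auto simp: vec_eq_iff transpose_def)
  then have "signed_pauli (transpose (pauli_mat P))" for P
    unfolding signed_pauli_def by metis
  moreover have "transpose (pauli_string p) = prod_op (\<lambda>q. transpose (pauli_mat (p q)))" for p :: "'a \<Rightarrow> pauli"
    by (simp add: vec_eq_iff pauli_string_def transpose_def prod_op_nth)
  ultimately have "hermitian_pauli (transpose (pauli_string p))" for p :: "'a \<Rightarrow> pauli"
    by (simp add: hermitian_pauli_prod_op)
  moreover have "transpose (- M) = - transpose M" for M :: "'a qop"
    by (simp add: vec_eq_iff transpose_def)
  ultimately show ?thesis
    using assms by (auto simp: hermitian_pauli_def[of G])
qed

text \<open>Transposition reverses products and changes a Pauli string at most by a sign, since Y is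
  the only antisymmetric Pauli matrix. It is needed for the second register of the ancilla, where
  operators act transposed.\<close>

lemma clifford_transpose:
  fixes W :: "'a::finite qop"
  assumes "clifford W"
  shows "clifford (transpose W)"
proof -
  have adj_transpose: "adj (transpose W) = transpose (adj W)"
    by (simp add: vec_eq_iff transpose_def)
  have "transpose (mat 1 :: 'a qop) = mat 1" by (rule transpose_mat)
  then have "unitary (transpose W)"
    using assms unfolding clifford_def unitary_def adj_transpose by (metis transpose_mult)
  moreover have conj: "transpose A ** G ** transpose B = transpose (B ** transpose G ** A)"
    for A B G :: "'a qop"
    by (simp add: transpose_mult matrix_mul_assoc)
  ultimately show ?thesis
    using assms by (intro cliffordI) (simp_all add: adj_transpose conj clifford_def
        hermitian_pauli_transpose)
qed


section \<open>Stabilizer states\<close>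

text \<open>Used to refute membership in a generated group: a vector fixed by all generators but
  moved by the candidate suffices.\<close>

lemma generated_fixes:
  "M \<in> generated S \<Longrightarrow> (\<And>G. G \<in> S \<Longrightarrow> G *v \<phi> = \<phi>) \<Longrightarrow> M *v \<phi> = \<phi>"
  by (induction rule: generated.induct) (simp_all flip: matrix_vector_mul_assoc)

lemma generated_conj:
  assumes "unitary W"
  shows "generated ((\<lambda>G. W ** G ** adj W) ` S) \<subseteq> (\<lambda>G. W ** G ** adj W) ` generated S"
proof
  fix M assume "M \<in> generated ((\<lambda>G. W ** G ** adj W) ` S)"
  then show "M \<in> (\<lambda>G. W ** G ** adj W) ` generated S"
  proof (induction rule: generated.induct)
    case one
    have "mat 1 = W ** mat 1 ** adj W" using assms by (simp add: unitary_def)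
    then show ?case using generated.one by blast
  next
    case (mult G M)
    then obtain G' M' where G': "G = W ** G' ** adj W" "G' \<in> S"
      and M': "M = W ** M' ** adj W" "M' \<in> generated S" by blast
    have "G ** M = W ** (G' ** ((adj W ** W) ** M')) ** adj W"
      by (simp add: G' M' matrix_mul_assoc)
    then have "G ** M = W ** (G' ** M') ** adj W"
      using assms by (simp add: unitary_def)
    then show ?case using G' M' generated.mult by blast
  qed
qed

text \<open>Conjugation by \<open>W\<close> is an injective homomorphism that preserves Hermitian
  Pauli operators and \<open>- mat 1\<close>. Hence it carries stabilizer generators of one state to
  generators of its image.\<close>

lemma stabilizer_state_clifford:
  assumes "clifford W" and "stabilizer_state \<Omega>"
  shows "stabilizer_state (W *v \<Omega>)"
proof -
  let ?c = "\<lambda>G. W ** G ** adj W"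
  have W: "unitary W" "adj W ** W = mat 1" "W ** adj W = mat 1"
    using assms(1) by (auto simp: clifford_def unitary_def)
  obtain S where S: "finite S" "card S = CARD('a)" "\<forall>G\<in>S. hermitian_pauli G"
    "\<forall>G\<in>S. \<forall>H\<in>S. G ** H = H ** G" "\<forall>G\<in>S. G \<notin> generated (S - {G})"
    "- mat 1 \<notin> generated S" "\<forall>G\<in>S. G *v \<Omega> = \<Omega>" "norm \<Omega> = 1"
    using assms(2) unfolding stabilizer_state_def by blast
  have "adj W ** ?c G ** W = G" for G
  proof -
    have "adj W ** ?c G ** W = (adj W ** W) ** G ** (adj W ** W)"
      by (simp only: matrix_mul_assoc)
    then show ?thesis by (simp add: W)
  qed
  then have inj: "inj ?c" by (rule inj_on_inverseI)
  have conj_mult: "?c G ** ?c H = ?c (G ** H)" for G H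
  proof -
    have "?c G ** ?c H = W ** (G ** ((adj W ** W) ** H)) ** adj W"
      by (simp only: matrix_mul_assoc)
    then show ?thesis by (simp add: W)
  qed
  \<comment> \<open>Membership in the conjugated group pulls back, so independence and the absence
    of \<open>- mat 1\<close> are inherited from \<open>S\<close>.\<close>
  have mem: "M \<in> generated T" if "?c M \<in> generated (?c ` T)" for M T
    using that generated_conj[OF W(1), of T] inj_image_mem_iff[OF inj, of M] by blast
  have "?c G \<notin> generated (?c ` S - {?c G})" if "G \<in> S" for G
  proof -
    have "?c ` S - {?c G} = ?c ` (S - {G})"
      by (simp add: image_set_diff[OF inj])
    then show ?thesis using mem[of G "S - {G}"] that S(5) by auto
  qed
  moreover have "?c (- mat 1) = - mat 1" by (simp add: W)
  then have "- mat 1 \<notin> generated (?c ` S)" using mem[of "- mat 1" S] S(6) by auto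
  moreover have "?c G *v (W *v \<Omega>) = W *v \<Omega>" if "G \<in> S" for G
  proof -
    have "?c G *v (W *v \<Omega>) = W *v (G *v ((adj W ** W) *v \<Omega>))"
      by (simp only: matrix_vector_mul_assoc matrix_mul_assoc)
    then show ?thesis using that S(7) by (simp add: W)
  qed
  moreover have "card (?c ` S) = CARD('a)"
    using S(2) inj by (simp add: card_image inj_on_def)
  moreover have "hermitian_pauli (?c G)" if "G \<in> S" for G
    using that S(3) assms(1) by (simp add: clifford_def)
  moreover have "?c G ** ?c H = ?c H ** ?c G" if "G \<in> S" "H \<in> S" for G H
    using that S(4) by (simp add: conj_mult)
  moreover have "norm (W *v \<Omega>) = 1"
    using norm_unitary[OF W(1), of \<Omega>] S(8) by simp
  moreover have "finite (?c ` S)" using S(1) by simp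
  ultimately show ?thesis
    unfolding stabilizer_state_def
    by (intro conjI exI[of _ "?c ` S"]) (simp_all add: image_iff Ball_def, auto)
qed

text \<open>Joint eigenvectors of Z on \<open>T\<close> and X elsewhere, with \<open>b\<close>
  giving the signs. The pattern with all signs positive is the state of interest; the others witness
  the independence of its stabilizers.\<close>

definition zx_ket :: "'q set \<Rightarrow> ('q::finite \<Rightarrow> bool) \<Rightarrow> 'q ket" where
  "zx_ket T b = product_ket (\<lambda>q. if q \<in> T then z_basis (b q) else x_basis (b q))"

lemma norm_zx_ket: "norm (zx_ket T b) = 1"
  unfolding zx_ket_def
proof (rule norm_product_ket)
  have "norm (z_basis a) = 1" for a
    by (cases a) (simp_all add: norm_vec_def L2_set_def UNIV_bool z_basis_def)
  moreover have "norm (x_basis a) = 1" for a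
    by (cases a) (simp_all add: norm_vec_def L2_set_def UNIV_bool x_basis_def norm_divide power_divide)
  ultimately show "norm (if q \<in> T then z_basis (b q) else x_basis (b q)) = 1" for q
    by simp
qed

lemma zx_ket_eigen:
  "pauli_string ((\<lambda>_. PI)(q := if q \<in> T then PZ else PX)) *v zx_ket T b =
     (if b q then - zx_ket T b else zx_ket T b)"
proof -
  let ?f = "\<lambda>q. if q \<in> T then z_basis (b q) else x_basis (b q)"
  have Z: "pauli_mat PZ *v z_basis a = (if a then - z_basis a else z_basis a)" for a
    by (cases a) (simp_all add: vec_eq_iff matrix_vector_mult_def UNIV_bool z_basis_def)
  have X: "pauli_mat PX *v x_basis a = (if a then - x_basis a else x_basis a)" for a
    by (cases a) (simp_all add: vec_eq_iff matrix_vector_mult_def UNIV_bool x_basis_def all_bool_eq)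
  have "pauli_mat (((\<lambda>_. PI)(q := if q \<in> T then PZ else PX)) r) *v ?f r =
      (if r = q \<and> b q then - ?f r else ?f r)" for r
    using Z X by (cases "r = q") (simp_all add: pauli_mat_PI del: pauli_mat.simps)
  then have "pauli_string ((\<lambda>_. PI)(q := if q \<in> T then PZ else PX)) *v zx_ket T b =
      product_ket (\<lambda>r. if r = q \<and> b q then - ?f r else ?f r)"
    unfolding pauli_string_eq_prod_op zx_ket_def prod_op_mult_vec by simp
  also have "\<dots> = (if b q then - zx_ket T b else zx_ket T b)"
  proof -
    have "(\<Prod>r\<in>UNIV. (if r = q \<and> b q then - ?f r else ?f r) $ x r) =
        (if b q then -1 else 1) * (\<Prod>r\<in>UNIV. ?f r $ x r)" for x
    proof -
      have "(\<Prod>r\<in>UNIV. (if r = q \<and> b q then - ?f r else ?f r) $ x r) =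
          (\<Prod>r\<in>UNIV. (if r = q then (if b q then -1 else 1) else 1) * ?f r $ x r)"
        by (rule prod.cong) auto
      then show ?thesis unfolding prod.distrib by simp
    qed
    then show ?thesis
      by (simp add: vec_eq_iff product_ket_def zx_ket_def)
  qed
  finally show ?thesis .
qed

lemma stabilizer_state_zx_ket: "stabilizer_state (zx_ket T (\<lambda>_. False))"
proof -
  define g where "g q = pauli_string ((\<lambda>_. PI)(q := if q \<in> T then PZ else PX))" for q
  have eigen: "g q *v zx_ket T b = (if b q then - zx_ket T b else zx_ket T b)" for q b
    by (simp add: g_def zx_ket_eigen)
  have nonzero: "zx_ket T b \<noteq> 0" "- zx_ket T b \<noteq> zx_ket T b" for b
  proof -
    show nz: "zx_ket T b \<noteq> 0" using norm_zx_ket[of T b] by auto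
    show "- zx_ket T b \<noteq> zx_ket T b"
    proof
      assume "- zx_ket T b = zx_ket T b"
      then have "- (zx_ket T b $ x) = zx_ket T b $ x" for x by (metis vector_uminus_component)
      then have "zx_ket T b = 0" by (simp add: vec_eq_iff equal_neg_zero neg_equal_zero)
      with nz show False ..
    qed
  qed
  have inj: "inj g"
  proof (rule injI, rule ccontr)
    fix q r assume "g q = g r" "q \<noteq> r"
    then show False
      using eigen[of q "\<lambda>s. s = q"] eigen[of r "\<lambda>s. s = q"] nonzero by auto
  qed
  have "g q \<notin> generated (range g - {g q})" for q
  proof
    assume "g q \<in> generated (range g - {g q})"
    \<comment> \<open>The eigenvector whose only negative sign sits at \<open>q\<close> is fixed by
      all other generators, but \<open>g q\<close> negates it.\<close>
    then have "g q *v zx_ket T (\<lambda>s. s = q) = zx_ket T (\<lambda>s. s = q)"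
      by (rule generated_fixes) (auto simp: eigen)
    then show False using eigen[of q "\<lambda>s. s = q"] nonzero by simp
  qed
  moreover have "- mat 1 \<notin> generated (range g)"
  proof
    assume "- mat 1 \<in> generated (range g)"
    then have "- mat 1 *v zx_ket T (\<lambda>_. False) = zx_ket T (\<lambda>_. False)"
      by (rule generated_fixes) (auto simp: eigen)
    moreover have "- mat 1 *v v = - v" for v :: "'a ket"
      by (simp add: vec_eq_iff matrix_vector_mult_def mat_def sum_negf if_distrib if_distribR cong: if_cong)
    ultimately show False using nonzero by simp
  qed
  moreover have "g q ** g r = g r ** g q" for q r
    by (cases "q = r"; unfold g_def pauli_string_eq_prod_op prod_op_mult;
        rule arg_cong[where f = prod_op]) (auto simp: fun_eq_iff pauli_mat_PI simp del: pauli_mat.simps)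
  moreover have "card (range g) = CARD('a)" using inj by (simp add: card_image)
  moreover have "hermitian_pauli (g q)" for q by (simp add: g_def)
  ultimately show ?thesis
    unfolding stabilizer_state_def
    by (intro conjI exI[of _ "range g"]) (simp_all add: norm_zx_ket eigen)
qed


section \<open>Measurement of commuting Pauli operators\<close>

lemma ket_eqI: "(\<And>x. u $ x = v $ x) \<Longrightarrow> u = v" for u v :: "'q::finite ket"
  by (simp add: vec_eq_iff)

section \<open>Addition of bit strings and the action of a two-block step\<close>

definition bxor :: "('q \<Rightarrow> bool) \<Rightarrow> ('q \<Rightarrow> bool) \<Rightarrow> 'q \<Rightarrow> bool" (infixl "\<oplus>" 65) where
  "a \<oplus> b = (\<lambda>q. a q \<noteq> b q)"

lemma bxor_cancel [simp]: "a \<oplus> b \<oplus> b = a" "(a \<oplus> b = c \<oplus> b) = (a = c)"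
  by (auto simp: bxor_def fun_eq_iff)

lemma bxor_False [simp]: "a \<oplus> (\<lambda>_. False) = a"
  by (simp add: bxor_def)

lemma sum_bxor: "(\<Sum>k\<in>UNIV. F (k \<oplus> v)) = (\<Sum>k\<in>UNIV. F k)"
  for F :: "('q::finite \<Rightarrow> bool) \<Rightarrow> 'c::comm_monoid_add"
proof (rule sum.reindex_bij_betw)
  show "bij_betw (\<lambda>k. k \<oplus> v) UNIV UNIV"
    by (rule bij_betw_byWitness[where f' = "\<lambda>k. k \<oplus> v"]) auto
qed

text \<open>The character (-1)^(u.a) of the group of bit strings. It is the sign in X-basis
  amplitudes and in the Hadamard kernel.\<close>

definition character :: "('q::finite \<Rightarrow> bool) \<Rightarrow> ('q \<Rightarrow> bool) \<Rightarrow> complex" where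
  "character u a = (\<Prod>q\<in>UNIV. if u q \<and> a q then -1 else 1)"

lemma character_bxor: "character u (a \<oplus> b) = character u a * character u b"
  unfolding character_def bxor_def prod.distrib[symmetric] by (rule prod.cong) auto

lemma character_square [simp]: "character u a * character u a = 1"
  unfolding character_def prod.distrib[symmetric] by (rule prod.neutral) auto

lemma x_ket_nth: "x_ket u $ a = character u a / complex_of_real (sqrt 2) ^ CARD('q)"
  for u :: "'q::finite \<Rightarrow> bool"
  unfolding x_ket_def product_ket_def character_def x_basis_def
  by (simp add: prod_dividef conj_commute)

lemma cnj_x_ket: "cnj (x_ket u $ a) = x_ket u $ a"
proof -
  have "cnj (character u a) = character u a"
    unfolding character_def cnj_prod by (rule prod.cong) auto
  then show ?thesis by (simp add: x_ket_nth)
qed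

lemma z_ket_nth: "z_ket v $ b = (if b = v then 1 else 0)"
  unfolding z_ket_def product_ket_def z_basis_def
  by (simp add: prod_indicator fun_eq_iff)

lemma cnj_z_ket: "cnj (z_ket v $ b) = z_ket v $ b"
  by (simp add: z_ket_nth)

text \<open>With controls and targets disjoint, the gate permutes basis states by an involution. The
  amplitude at \<open>x\<close> is therefore read at the image of \<open>x\<close> itself, with no
  separate inverse map.\<close>

lemma transversal_cnot_mult_vec:
  assumes "range c \<inter> range t = {}"
  shows "(transversal_cnot c t *v \<phi>) $ x = \<phi> $ (\<lambda>q. x q \<noteq> (\<exists>j. q = t j \<and> x (c j)))"
proof -
  define f where "f x = (\<lambda>q. x q \<noteq> (\<exists>j. q = t j \<and> x (c j)))" for x
  have c: "f k (c j) = k (c j)" for k j using assms unfolding f_def by blast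
  have involution: "f (f k) = k" for k
    by (rule ext) (subst f_def, unfold c, unfold f_def, blast)
  then have eq: "x = f k \<longleftrightarrow> k = f x" for k
    by (auto simp: involution)
  have "(transversal_cnot c t *v \<phi>) $ x = (\<Sum>k\<in>UNIV. (if k = f x then 1 else 0) * \<phi> $ k)"
    unfolding matrix_vector_mult_def transversal_cnot_def vec_lambda_beta f_def[symmetric] eq
    by (rule refl)
  also have "\<dots> = (\<Sum>k\<in>UNIV. if k = f x then \<phi> $ f x else 0)"
    by (rule sum.cong) auto
  finally show ?thesis by (simp add: f_def)
qed

lemma transversal_cnot_Inr_Inl_nth:
  "(transversal_cnot Inr Inl *v \<Psi>) $ z = \<Psi> $ case_sum ((z \<circ> Inl) \<oplus> (z \<circ> Inr)) (z \<circ> Inr)"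
  for \<Psi> :: "('a::finite + 'a) ket"
proof -
  have "(\<lambda>q. z q \<noteq> (\<exists>j. q = Inl j \<and> z (Inr j))) = case_sum ((z \<circ> Inl) \<oplus> (z \<circ> Inr)) (z \<circ> Inr)"
    by (auto simp: bxor_def fun_eq_iff split: sum.splits)
  then show ?thesis
    by (subst transversal_cnot_mult_vec) (blast, simp only:)
qed

lemma transversal_cnot_Inl_Inr_nth:
  "(transversal_cnot Inl Inr *v \<Psi>) $ z = \<Psi> $ case_sum (z \<circ> Inl) ((z \<circ> Inr) \<oplus> (z \<circ> Inl))"
  for \<Psi> :: "('a::finite + 'a) ket"
proof -
  have "(\<lambda>q. z q \<noteq> (\<exists>j. q = Inr j \<and> z (Inl j))) = case_sum (z \<circ> Inl) ((z \<circ> Inr) \<oplus> (z \<circ> Inl))"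
    by (auto simp: bxor_def fun_eq_iff split: sum.splits)
  then show ?thesis
    by (subst transversal_cnot_mult_vec) (blast, simp only:)
qed

text \<open>The gate action of the gadget as a matrix: \<open>k\<close> is the input string of the
  working register and \<open>y\<close> the output string. The first block must then hold their sum,
  and the Z outcome \<open>v\<close> ties the second block to \<open>k\<close>.\<close>

lemma after_step_Two_Block:
  "after_step (Two_Block Gs \<Omega>) (XZ_Bits u v) \<phi> $ y =
     (\<Sum>k\<in>UNIV. x_ket u $ (y \<oplus> k) * \<Omega> $ case_sum (y \<oplus> k) (k \<oplus> v) * \<phi> $ k)"
proof -
  let ?T1 = "transversal_cnot (\<lambda>j. Inl (Inl j)) Inr :: (('a + 'a) + 'a) qop"
  let ?T2 = "transversal_cnot Inr (\<lambda>j. Inl (Inr j)) :: (('a + 'a) + 'a) qop"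
  have T: "(?T1 *v (?T2 *v tensor \<Omega> \<phi>)) $ case_sum (case_sum a b) y =
      \<Omega> $ case_sum a (b \<oplus> (y \<oplus> a)) * \<phi> $ (y \<oplus> a)" for a b
  proof -
    have "(\<lambda>q. case_sum (case_sum a b) w q \<noteq> (\<exists>j. q = Inr j \<and> case_sum (case_sum a b) w (Inl (Inl j)))) =
        case_sum (case_sum a b) (w \<oplus> a)" for w
      by (auto simp: bxor_def fun_eq_iff split: sum.splits)
    then have T1: "(?T1 *v \<Psi>) $ case_sum (case_sum a b) w = \<Psi> $ case_sum (case_sum a b) (w \<oplus> a)" for \<Psi> w
      by (subst transversal_cnot_mult_vec) (blast, simp only:)
    have "(\<lambda>q. case_sum (case_sum a b) w q \<noteq> (\<exists>j. q = Inl (Inr j) \<and> case_sum (case_sum a b) w (Inr j))) =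
        case_sum (case_sum a (b \<oplus> w)) w" for w
      by (auto simp: bxor_def fun_eq_iff split: sum.splits)
    then have T2: "(?T2 *v \<Psi>) $ case_sum (case_sum a b) w = \<Psi> $ case_sum (case_sum a (b \<oplus> w)) w" for \<Psi> w
      by (subst transversal_cnot_mult_vec) (blast, simp only:)
    show ?thesis by (simp add: T1 T2)
  qed
  have "after_step (Two_Block Gs \<Omega>) (XZ_Bits u v) \<phi> $ y =
      (\<Sum>a\<in>UNIV. \<Sum>b\<in>UNIV. x_ket u $ a * (if b = v then 1 else 0) *
        (\<Omega> $ case_sum a (b \<oplus> (y \<oplus> a)) * \<phi> $ (y \<oplus> a)))"
    unfolding z_ket_nth[symmetric] by (simp add: contract_def sum_sum_assignment T cnj_x_ket cnj_z_ket)
  also have "\<dots> = (\<Sum>a\<in>UNIV. x_ket u $ a * (\<Omega> $ case_sum a (v \<oplus> (y \<oplus> a)) * \<phi> $ (y \<oplus> a)))"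
  proof (rule sum.cong[OF refl])
    fix a
    have "(\<Sum>b\<in>UNIV. x_ket u $ a * (if b = v then 1 else 0) *
        (\<Omega> $ case_sum a (b \<oplus> (y \<oplus> a)) * \<phi> $ (y \<oplus> a))) =
        (\<Sum>b\<in>UNIV. if b = v then x_ket u $ a * (\<Omega> $ case_sum a (v \<oplus> (y \<oplus> a)) * \<phi> $ (y \<oplus> a)) else 0)"
      by (rule sum.cong) auto
    then show "(\<Sum>b\<in>UNIV. x_ket u $ a * (if b = v then 1 else 0) *
        (\<Omega> $ case_sum a (b \<oplus> (y \<oplus> a)) * \<phi> $ (y \<oplus> a))) =
        x_ket u $ a * (\<Omega> $ case_sum a (v \<oplus> (y \<oplus> a)) * \<phi> $ (y \<oplus> a))"
      by simp
  qed
  \<comment> \<open>Reindexing replaces the first-block string by the input string: the old index is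
    the sum of the new one with \<open>y\<close>.\<close>
  also have "\<dots> = (\<Sum>k\<in>UNIV. x_ket u $ (k \<oplus> y) *
      (\<Omega> $ case_sum (k \<oplus> y) (v \<oplus> (y \<oplus> (k \<oplus> y))) * \<phi> $ (y \<oplus> (k \<oplus> y))))"
    by (rule sum_bxor[symmetric])
  also have "\<dots> = (\<Sum>k\<in>UNIV. x_ket u $ (y \<oplus> k) * \<Omega> $ case_sum (y \<oplus> k) (k \<oplus> v) * \<phi> $ k)"
  proof (rule sum.cong[OF refl])
    fix k
    have "y \<oplus> (k \<oplus> y) = k" "v \<oplus> (y \<oplus> (k \<oplus> y)) = k \<oplus> v" "k \<oplus> y = y \<oplus> k"
      by (auto simp: bxor_def)
    then show "x_ket u $ (k \<oplus> y) *
        (\<Omega> $ case_sum (k \<oplus> y) (v \<oplus> (y \<oplus> (k \<oplus> y))) * \<phi> $ (y \<oplus> (k \<oplus> y))) =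
        x_ket u $ (y \<oplus> k) * \<Omega> $ case_sum (y \<oplus> k) (k \<oplus> v) * \<phi> $ k"
      by simp
  qed
  finally show ?thesis .
qed

text \<open>Conjugation by the Pauli operator with \<open>Z\<close>-part \<open>u\<close> and \<open>X\<close>-part \<open>v\<close>.\<close>

definition twirl :: "('q::finite \<Rightarrow> bool) \<Rightarrow> ('q \<Rightarrow> bool) \<Rightarrow> 'q qop \<Rightarrow> 'q qop" where
  "twirl u v M = (\<chi> x y. character u x * character u y * M $ (x \<oplus> v) $ (y \<oplus> v))"

text \<open>At the summation index the two characters cancel, and the shift by \<open>v\<close> only
  reindexes the sum.\<close>

lemma twirl_mult: "twirl u v (A ** B) = twirl u v A ** twirl u v B"
proof -
  have "(twirl u v A ** twirl u v B) $ x $ y = twirl u v (A ** B) $ x $ y" for x y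
  proof -
    have "(twirl u v A ** twirl u v B) $ x $ y =
        (\<Sum>k\<in>UNIV. character u x * character u y * (character u k * character u k) *
          (A $ (x \<oplus> v) $ (k \<oplus> v) * B $ (k \<oplus> v) $ (y \<oplus> v)))"
      by (simp add: matrix_matrix_mult_def twirl_def mult_ac del: character_square)
    also have "\<dots> = character u x * character u y *
        (\<Sum>k\<in>UNIV. A $ (x \<oplus> v) $ (k \<oplus> v) * B $ (k \<oplus> v) $ (y \<oplus> v))"
      by (simp add: sum_distrib_left mult_ac)
    also have "\<dots> = twirl u v (A ** B) $ x $ y"
      unfolding sum_bxor[of "\<lambda>k. A $ (x \<oplus> v) $ k * B $ k $ (y \<oplus> v)"]
      by (simp add: twirl_def matrix_matrix_mult_def)
    finally show ?thesis .
  qed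
  then show ?thesis by (simp add: vec_eq_iff)
qed

lemma twirl_linear:
  "twirl u v (mat 1) = mat 1" "twirl u v (- A) = - twirl u v A"
  "twirl u v (A + B) = twirl u v A + twirl u v B" "twirl u v (r *\<^sub>R A) = r *\<^sub>R twirl u v A"
  by (simp_all add: vec_eq_iff twirl_def mat_def algebra_simps)

lemma twirl_hermitian_pauli:
  assumes "hermitian_pauli G"
  shows "twirl u v G = G \<or> twirl u v G = - G"
proof -
  have "twirl u v (pauli_string p) = pauli_string p \<or> twirl u v (pauli_string p) = - pauli_string p" for p
  proof -
    \<comment> \<open>\<open>e q\<close> records whether the factor at \<open>q\<close> anticommutes
      with the conjugating Pauli factor: X sees only the Z-part, Z only the X-part, and Y their
      sum.\<close>
    define e where "e q = (case p q of PI \<Rightarrow> False | PX \<Rightarrow> u q | PY \<Rightarrow> u q \<noteq> v q | PZ \<Rightarrow> v q)" for q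
    have "(if u q \<and> a then -1 else 1) * (if u q \<and> b then -1 else 1) * pauli_mat (p q) $ (a \<noteq> v q) $ (b \<noteq> v q) =
        (if e q then -1 else 1) * pauli_mat (p q) $ a $ b" for q a b
      unfolding e_def by (cases "p q") auto
    then have "twirl u v (pauli_string p) $ x $ y = (\<Prod>q\<in>UNIV. if e q then -1 else 1) * pauli_string p $ x $ y" for x y
      by (simp add: twirl_def character_def pauli_string_def bxor_def flip: prod.distrib)
    then show ?thesis
      using prod_signs[of e UNIV] by (auto simp: vec_eq_iff)
  qed
  then show ?thesis
    using assms unfolding hermitian_pauli_def by (metis minus_minus twirl_linear(2))
qed

lemma twirl_signed_projector:
  assumes "\<forall>G\<in>set Gs. hermitian_pauli G" and "length s = length Gs"
  shows "\<exists>s'. length s' = length Gs \<and>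
    twirl u v (signed_projector (zip Gs s)) = signed_projector (zip Gs s')"
  using assms
proof (induction Gs arbitrary: s)
  case Nil
  then show ?case by (simp add: twirl_linear)
next
  case (Cons G Gs)
  then obtain b s1 where s: "s = b # s1" by (cases s) auto
  with Cons obtain s' where s': "length s' = length Gs"
    "twirl u v (signed_projector (zip Gs s1)) = signed_projector (zip Gs s')" by auto
  obtain b' where "twirl u v (if b then - G else G) = (if b' then - G else G)"
  proof -
    have "twirl u v G = G \<or> twirl u v G = - G"
      using Cons.prems by (simp add: twirl_hermitian_pauli)
    then show ?thesis
      using that[of b] that[of "\<not> b"] by (auto simp: twirl_linear)
  qed
  with s' show ?case
    by (intro exI[of _ "b' # s'"]) (simp add: s twirl_mult twirl_linear)
qed

text \<open>The unnormalised Choi vector of \<open>M\<close>: row index in the first register,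
  column index in the second.\<close>

definition vectorize :: "'q::finite qop \<Rightarrow> ('q + 'q) ket" where
  "vectorize M = (\<chi> z. M $ (z \<circ> Inl) $ (z \<circ> Inr))"

text \<open>The CNOT gives \<open>\<Omega>\<close> the amplitude of the projector at row a + b and
  column b. In the gadget a = y + j and b = j + v, so the row becomes y + v and the column j + v,
  while the X-basis amplitude factors into characters of \<open>y\<close> and \<open>j\<close>. This
  is the projector conjugated by a Pauli operator, which differs from it only in the signs.\<close>

lemma measures_correctly_Two_Block:
  fixes Gs :: "'q::finite qop list"
  assumes "\<forall>G\<in>set Gs. hermitian_pauli G" and "k \<noteq> 0"
    and \<Omega>: "\<Omega> = k *s (transversal_cnot Inr Inl *v vectorize (signed_projector (zip Gs (map (\<lambda>_. False) Gs))))"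
  shows "measures_correctly (Two_Block Gs \<Omega>)"
proof -
  let ?M = "signed_projector (zip Gs (map (\<lambda>_. False) Gs))"
  let ?c = "k / complex_of_real (sqrt 2) ^ CARD('q)"
  have "\<exists>s. length s = length Gs \<and>
      (\<forall>\<phi>. after_step (Two_Block Gs \<Omega>) (XZ_Bits u v) \<phi> = ?c *s (signed_projector (zip Gs s) *v \<phi>))" for u v
  proof -
    obtain s where s: "length s = length Gs" "twirl u v ?M = signed_projector (zip Gs s)"
      using twirl_signed_projector[OF assms(1)] by (metis length_map)
    have "after_step (Two_Block Gs \<Omega>) (XZ_Bits u v) \<phi> $ y = (?c *s (twirl u v ?M *v \<phi>)) $ y" for \<phi> y
    proof -
      have "y \<oplus> j \<oplus> (j \<oplus> v) = y \<oplus> v" for j by (auto simp: bxor_def)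
      then have "\<Omega> $ case_sum (y \<oplus> j) (j \<oplus> v) = k * ?M $ (y \<oplus> v) $ (j \<oplus> v)" for j
        by (simp add: \<Omega> transversal_cnot_Inr_Inl_nth vectorize_def)
      then show ?thesis
        unfolding after_step_Two_Block
        by (simp add: x_ket_nth character_bxor matrix_vector_mult_def twirl_def sum_distrib_left mult_ac)
    qed
    then have "after_step (Two_Block Gs \<Omega>) (XZ_Bits u v) \<phi> = ?c *s (signed_projector (zip Gs s) *v \<phi>)" for \<phi>
      unfolding s(2)[symmetric] by (rule ket_eqI)
    with s(1) show ?thesis by blast
  qed
  moreover have "?c \<noteq> 0" using assms(2) by simp
  ultimately show ?thesis
    unfolding measures_correctly_def outcomes.simps measured.simps by blast
qed

section \<open>Measuring Z operators conjugated by a Clifford operator\<close>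

definition pauli_z :: "'q::finite \<Rightarrow> 'q qop" where
  "pauli_z q = pauli_string ((\<lambda>_. PI)(q := PZ))"

lemma pauli_z_nth: "pauli_z q $ x $ y = (if x = y then (if x q then -1 else 1) else 0)"
proof -
  have "(\<lambda>r. pauli_mat (((\<lambda>_. PI)(q := PZ)) r)) = (\<lambda>_. mat 1)(q := pauli_mat PZ)"
    by (auto simp: pauli_mat_PI simp del: pauli_mat.simps)
  then have "pauli_z q = on_qubit q (pauli_mat PZ)"
    by (simp add: pauli_z_def pauli_string_eq_prod_op on_qubit_eq_prod_op)
  then show ?thesis
    by (auto simp: on_qubit_def fun_eq_iff)
qed

text \<open>Each factor (I + Z)/2 or (I - Z)/2 fixes one bit. Between consecutive conjugated factors
  \<open>W ** adj W\<close> cancels, so the bit conditions accumulate in a single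
  \<open>diag\<close>.\<close>

lemma signed_projector_conj_pauli_z:
  assumes "unitary W"
  shows "signed_projector (zip (map (\<lambda>q. adj W ** pauli_z q ** W) ts) (map r ts)) =
    adj W ** diag (\<lambda>x. \<forall>q\<in>set ts. x q = r q) ** W"
proof (induction ts)
  case Nil
  have "diag (\<lambda>_. True) = (mat 1 :: 'a qop)" by (simp add: diag_def mat_def)
  then show ?case using assms by (simp add: unitary_def)
next
  case (Cons q ts)
  have W: "adj W ** W = mat 1" "W ** adj W = mat 1" using assms by (auto simp: unitary_def)
  have half: "(1/2) *\<^sub>R (mat 1 + (if b then - pauli_z q else pauli_z q)) = diag (\<lambda>x. x q = b)" for b
    by (auto simp: vec_eq_iff diag_def mat_def pauli_z_nth scaleR_conv_of_real[of _ z for z :: complex])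
  have "(1/2) *\<^sub>R (mat 1 + (if b then - (adj W ** pauli_z q ** W) else adj W ** pauli_z q ** W)) =
      adj W ** diag (\<lambda>x. x q = b) ** W" for b
  proof -
    have "adj W ** ((1/2) *\<^sub>R (mat 1 + (if b then - pauli_z q else pauli_z q))) ** W =
        (1/2) *\<^sub>R (adj W ** mat 1 ** W + adj W ** (if b then - pauli_z q else pauli_z q) ** W)"
      by (simp add: matrix_mult_scaleR matrix_add_ldistrib matrix_mult_add_left)
    then show ?thesis unfolding half by (simp add: W)
  qed
  then have "signed_projector (zip (map (\<lambda>q. adj W ** pauli_z q ** W) (q # ts)) (map r (q # ts))) =
      adj W ** (diag (\<lambda>x. x q = r q) ** ((W ** adj W) ** diag (\<lambda>x. \<forall>q\<in>set ts. x q = r q))) ** W"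
    by (simp add: Cons.IH matrix_mul_assoc)
  also have "\<dots> = adj W ** diag (\<lambda>x. \<forall>q\<in>set (q # ts). x q = r q) ** W"
    by (simp add: W diag_mult_diag)
  finally show ?case .
qed

text \<open>
  The inner part is the vectorisation of the projector onto \<open>|0>\<close> on \<open>T\<close>: \<open>|00>\<close> for qubits in
  \<open>T\<close> and Bell pairs for the others. The next factor conjugates it by \<open>W\<close>.
\<close>

definition conj_resource :: "'q::finite qop \<Rightarrow> 'q set \<Rightarrow> ('q + 'q) ket" where
  "conj_resource W T = transversal_cnot Inr Inl *v (kron (adj W) (transpose W) *v
     (transversal_cnot Inr Inl *v zx_ket (range Inl \<union> Inr ` T) (\<lambda>_. False)))"

lemma stabilizer_state_conj_resource: "clifford W \<Longrightarrow> stabilizer_state (conj_resource W T)"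
  unfolding conj_resource_def
  by (intro stabilizer_state_clifford stabilizer_state_zx_ket clifford_kron clifford_adj
      clifford_transpose clifford_transversal_cnot) auto

text \<open>An operator on the second register acts on the column index, hence from the right and
  transposed. This accounts for \<open>transpose W\<close> in \<open>conj_resource\<close>.\<close>

lemma kron_mult_vectorize: "kron A (transpose B) *v vectorize M = vectorize (A ** M ** B)"
proof -
  have "(kron A (transpose B) *v vectorize M) $ z = vectorize (A ** M ** B) $ z" for z
  proof -
    have "(kron A (transpose B) *v vectorize M) $ z =
        (\<Sum>a\<in>UNIV. \<Sum>b\<in>UNIV. A $ (z \<circ> Inl) $ a * M $ a $ b * B $ b $ (z \<circ> Inr))"
      by (simp add: matrix_vector_mult_def sum_sum_assignment vectorize_def transpose_def mult_ac)
    also have "\<dots> = vectorize (A ** M ** B) $ z"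
      by (subst sum.swap) (simp add: vectorize_def matrix_matrix_mult_def sum_distrib_right)
    finally show ?thesis .
  qed
  then show ?thesis by (simp add: vec_eq_iff)
qed

text \<open>The first register starts in |0>, so the CNOT copies the second into it and produces a
  sum of |bb> over strings b that vanish on \<open>T\<close>. Each qubit outside \<open>T\<close>
  starts in |+> and contributes a factor 1/sqrt 2.\<close>

lemma transversal_cnot_zx_ket:
  fixes T :: "'a::finite set"
  shows "transversal_cnot Inr Inl *v zx_ket (range Inl \<union> Inr ` T) (\<lambda>_. False) =
     (1 / complex_of_real (sqrt 2)) ^ card (- T) *s vectorize (diag (\<lambda>x. \<forall>q\<in>T. \<not> x q))"
proof -
  have prod_if: "(\<Prod>q\<in>UNIV. if q \<in> T then if x q then 0 else 1 else h) =
      (if \<forall>q\<in>T. \<not> x q then h ^ card (- T) else 0)" for x and h :: complex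
  proof -
    have "(\<Prod>q\<in>UNIV. if q \<in> T then if x q then 0 else 1 else h) =
        (\<Prod>q\<in>T. if x q then 0 else 1) * (\<Prod>q\<in>-T. h)"
      by (subst prod.If_cases) (auto simp: Compl_eq)
    then show ?thesis by auto
  qed
  have "zx_ket (range Inl \<union> Inr ` T) (\<lambda>_. False) $ case_sum a b =
      (if \<forall>q. \<not> a q then 1 else 0) * (if \<forall>q\<in>T. \<not> b q then (1 / complex_of_real (sqrt 2)) ^ card (- T) else 0)"
    for a b :: "'a \<Rightarrow> bool"
  proof -
    have mem: "Inr q \<in> range Inl \<union> Inr ` T \<longleftrightarrow> q \<in> T" for q by auto
    have "zx_ket (range Inl \<union> Inr ` T) (\<lambda>_. False) $ case_sum a b =
        (\<Prod>q\<in>UNIV. z_basis False $ a q) *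
        (\<Prod>q\<in>UNIV. (if q \<in> T then z_basis False else x_basis False) $ b q)"
      unfolding zx_ket_def product_ket_def vec_lambda_beta prod_UNIV_sum mem by simp
    also have "(\<Prod>q\<in>UNIV. z_basis False $ a q) = (if \<forall>q. \<not> a q then 1 else 0)"
      by (simp add: z_basis_def prod_indicator)
    also have "(\<Prod>q\<in>UNIV. (if q \<in> T then z_basis False else x_basis False) $ b q) =
        (\<Prod>q\<in>UNIV. if q \<in> T then if b q then 0 else 1 else 1 / complex_of_real (sqrt 2))"
      by (rule prod.cong) (auto simp: z_basis_def x_basis_def)
    finally show ?thesis unfolding prod_if .
  qed
  moreover have "(\<forall>q. \<not> (a \<oplus> b) q) \<longleftrightarrow> a = b" for a b :: "'a \<Rightarrow> bool"
    by (auto simp: bxor_def)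
  ultimately have entry: "(transversal_cnot Inr Inl *v zx_ket (range Inl \<union> Inr ` T) (\<lambda>_. False)) $ z =
      ((1 / complex_of_real (sqrt 2)) ^ card (- T) *s vectorize (diag (\<lambda>x. \<forall>q\<in>T. \<not> x q))) $ z"
    if "z \<circ> Inl = a" "z \<circ> Inr = b" for z and a b :: "'a \<Rightarrow> bool"
    by (simp add: transversal_cnot_Inr_Inl_nth vectorize_def diag_def that fun_cong[OF that(1), simplified])
  show ?thesis
  proof (rule ket_eqI)
    fix z :: "'a + 'a \<Rightarrow> bool"
    show "(transversal_cnot Inr Inl *v zx_ket (range Inl \<union> Inr ` T) (\<lambda>_. False)) $ z =
        ((1 / complex_of_real (sqrt 2)) ^ card (- T) *s vectorize (diag (\<lambda>x. \<forall>q\<in>T. \<not> x q))) $ z"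
      by (rule entry[of z "z \<circ> Inl" "z \<circ> Inr", OF refl refl])
  qed
qed

lemma conj_resource_eq:
  "conj_resource W T = (1 / complex_of_real (sqrt 2)) ^ card (- T) *s
     (transversal_cnot Inr Inl *v vectorize (adj W ** diag (\<lambda>x. \<forall>q\<in>T. \<not> x q) ** W))"
  by (simp only: conj_resource_def transversal_cnot_zx_ket vector_scalar_commute kron_mult_vectorize)

definition conj_step :: "'q::finite qop \<Rightarrow> 'q list \<Rightarrow> 'q step" where
  "conj_step W ts = Two_Block (map (\<lambda>q. adj W ** pauli_z q ** W) ts) (conj_resource W (set ts))"

lemma pauli_measurement_step_conj_step:
  assumes "clifford W"
  shows "pauli_measurement_step (conj_step W ts)"
proof -
  let ?G = "\<lambda>q. adj W ** pauli_z q ** W"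
  have W: "unitary W" using assms by (simp add: clifford_def)
  have hermitian: "hermitian_pauli (?G q)" for q
    using assms by (simp add: clifford_def pauli_z_def)
  have "pauli_z q ** pauli_z r = pauli_z r ** pauli_z q" for q r :: 'a
    by (cases "q = r"; unfold pauli_z_def pauli_string_eq_prod_op prod_op_mult;
      rule arg_cong[where f = prod_op]) (auto simp: fun_eq_iff pauli_mat_PI simp del: pauli_mat.simps)
  \<comment> \<open>Inserting \<open>W ** adj W\<close> in the middle reduces commutation of the
    conjugates to that of the Z operators.\<close>
  moreover have "?G q ** ?G r = adj W ** (pauli_z q ** ((W ** adj W) ** pauli_z r)) ** W" for q r
    by (simp only: matrix_mul_assoc)
  ultimately have commute: "?G q ** ?G r = ?G r ** ?G q" for q r
    using W by (simp add: unitary_def)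
  have "signed_projector (zip (map ?G ts) (map (\<lambda>_. False) (map ?G ts))) =
      adj W ** diag (\<lambda>x. \<forall>q\<in>set ts. \<not> x q) ** W"
    using signed_projector_conj_pauli_z[OF W, of ts "\<lambda>_. False"] by (simp add: comp_def)
  then have resource: "conj_resource W (set ts) = (1 / complex_of_real (sqrt 2)) ^ card (- set ts) *s
      (transversal_cnot Inr Inl *v vectorize (signed_projector (zip (map ?G ts) (map (\<lambda>_. False) (map ?G ts)))))"
    by (simp only: conj_resource_eq)
  have "measures_correctly (conj_step W ts)"
    unfolding conj_step_def
    by (rule measures_correctly_Two_Block[OF _ _ resource]) (auto simp: hermitian)
  moreover have "\<forall>G\<in>set (map ?G ts). hermitian_pauli G"
    using hermitian by simp
  moreover have "\<forall>G\<in>set (map ?G ts). \<forall>H\<in>set (map ?G ts). G ** H = H ** G"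
    unfolding set_map using commute by blast
  moreover have "stabilizer_state (conj_resource W (set ts))"
    using assms by (rule stabilizer_state_conj_resource)
  ultimately show ?thesis
    unfolding pauli_measurement_step_def conj_step_def measured.simps admissible_resource.simps
    by (intro conjI)
qed

text \<open>An outcome yields one sign per entry of \<open>ts\<close>. As the entries are distinct,
  these signs form a function \<open>r\<close> on qubits, and the projection fixes the bits to
  \<open>r\<close> in the frame of \<open>W\<close>.\<close>

lemma after_conj_step:
  assumes "clifford W" and "distinct ts" and "b \<in> outcomes (conj_step W ts)"
  shows "\<exists>c r. c \<noteq> 0 \<and> (\<forall>\<phi>. after_step (conj_step W ts) b \<phi> =
    c *s (adj W *v (diag (\<lambda>x. \<forall>q\<in>set ts. x q = r q) *v (W *v \<phi>))))"
proof -
  have "measures_correctly (conj_step W ts)"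
    using pauli_measurement_step_conj_step[OF assms(1)] by (simp add: pauli_measurement_step_def)
  then obtain s c where "length s = length (measured (conj_step W ts))" "c \<noteq> 0"
    "\<And>\<phi>. after_step (conj_step W ts) b \<phi> =
       c *s (signed_projector (zip (measured (conj_step W ts)) s) *v \<phi>)"
    using assms(3) unfolding measures_correctly_def by blast
  moreover have "measured (conj_step W ts) = map (\<lambda>q. adj W ** pauli_z q ** W) ts"
    by (simp add: conj_step_def)
  ultimately have s: "length s = length ts" "c \<noteq> 0"
    "\<And>\<phi>. after_step (conj_step W ts) b \<phi> =
       c *s (signed_projector (zip (map (\<lambda>q. adj W ** pauli_z q ** W) ts) s) *v \<phi>)"
    by simp_all
  \<comment> \<open>Outside \<open>ts\<close> this is an arbitrary value; the projector reads
    \<open>r\<close> on \<open>set ts\<close> only.\<close>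
  define r where "r q = the (map_of (zip ts s) q)" for q
  have "s = map r ts"
    using s(1) assms(2) unfolding r_def
    by (intro nth_equalityI) (simp_all add: map_of_zip_nth)
  then have "after_step (conj_step W ts) b \<phi> =
      c *s (adj W *v (diag (\<lambda>x. \<forall>q\<in>set ts. x q = r q) *v (W *v \<phi>)))" for \<phi>
    using s(3) signed_projector_conj_pauli_z[of W ts r] assms(1)
    by (simp add: clifford_def matrix_vector_mul_assoc matrix_mul_assoc)
  then show ?thesis using s(2) by blast
qed

section \<open>Padding steps that measure nothing\<close>

lemma after_step_First_Block_zero:
  "after_step (First_Block [] (z_ket (\<lambda>_. False))) (X_Bits u) \<phi> =
     (1 / complex_of_real (sqrt 2) ^ CARD('q)) *s \<phi>"
  for \<phi> :: "'q::finite ket"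
proof -
  have "after_step (First_Block [] (z_ket (\<lambda>_. False))) (X_Bits u) \<phi> $ y =
      x_ket u $ (\<lambda>_. False) * \<phi> $ y" for y
  proof -
    have "after_step (First_Block [] (z_ket (\<lambda>_. False))) (X_Bits u) \<phi> $ y =
        (\<Sum>a\<in>UNIV. x_ket u $ a * (z_ket (\<lambda>_. False) $ a * \<phi> $ (y \<oplus> a)))"
      unfolding after_step.simps(3) contract_def vec_lambda_beta
      by (simp only: transversal_cnot_Inl_Inr_nth cnj_x_ket tensor_nth case_sum_comp)
    \<comment> \<open>All controls are in |0>, so the CNOT gates never fire and only the zero string
      of the block contributes.\<close>
    also have "\<dots> = (\<Sum>a\<in>UNIV. if a = (\<lambda>_ :: 'q. False) then x_ket u $ (\<lambda>_. False) * \<phi> $ y else 0)"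
      unfolding z_ket_nth by (rule sum.cong) auto
    also have "\<dots> = x_ket u $ (\<lambda>_. False) * \<phi> $ y" by simp
    finally show ?thesis .
  qed
  moreover have "character u (\<lambda>_. False) = 1" by (simp add: character_def)
  ultimately show ?thesis
    by (intro ket_eqI) (simp add: x_ket_nth del: after_step.simps)
qed

lemma First_Block_trivial: "pauli_measurement_step (First_Block [] (z_ket (\<lambda>_. False) :: 'q::finite ket))"
proof -
  let ?S = "First_Block [] (z_ket (\<lambda>_. False) :: 'q ket)"
  have "\<exists>c. c \<noteq> 0 \<and> (\<forall>\<phi>. after_step ?S b \<phi> = c *s \<phi>)" if b: "b \<in> outcomes ?S" for b
  proof -
    obtain u where "b = X_Bits u" using b by auto
    then show ?thesis
      by (intro exI[of _ "1 / complex_of_real (sqrt 2) ^ CARD('q)"])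
        (simp only: after_step_First_Block_zero, simp)
  qed
  then have "measures_correctly ?S"
    unfolding measures_correctly_def by (auto simp del: after_step.simps outcomes.simps)
  moreover have "stabilizer_state (z_ket (\<lambda>_. False) :: 'q ket)"
    using stabilizer_state_zx_ket[of "UNIV :: 'q set"] by (simp add: zx_ket_def z_ket_def)
  ultimately show ?thesis by (simp add: pauli_measurement_step_def)
qed

lemma Direct_trivial: "pauli_measurement_step (Direct [] :: 'q::finite step)"
proof -
  have "\<exists>s c. length s = 0 \<and> c \<noteq> 0 \<and> (\<forall>\<phi> :: 'q ket. \<phi> = c *s \<phi>)"
    by (rule exI[of _ "[]"], rule exI[of _ 1]) simp
  then show ?thesis
    by (simp add: pauli_measurement_step_def measures_correctly_def)
qed


section \<open>Teleportation through a Clifford operator\<close>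

lemma pauli_string_PI: "pauli_string (\<lambda>_. PI) = mat 1"
  unfolding pauli_string_eq_prod_op pauli_mat_PI by (rule prod_op_mat_1)

text \<open>The empty projector is the identity, so each step only rescales the state. The scalar is
  chosen before \<open>h\<close> and \<open>\<phi>\<close>, so it depends on the outcomes but not on
  the input.\<close>

lemma run_trivial_steps:
  assumes "list_all2 (\<lambda>b S. b \<in> outcomes S) bs steps"
    and "\<And>S. S \<in> set steps \<Longrightarrow> measures_correctly S \<and> measured S = []"
  shows "\<exists>c. \<forall>h \<phi>. run (\<lambda>_ _. PI) h (zip steps bs) \<phi> = c *s \<phi>"
  using assms
proof (induction bs steps rule: list_all2_induct)
  case Nil
  show ?case by (rule exI[of _ 1]) (simp add: pauli_string_PI)
next
  case (Cons b bs S steps)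
  then obtain c where c: "\<And>h \<phi>. run (\<lambda>_ _. PI) h (zip steps bs) \<phi> = c *s \<phi>" by auto
  have "measures_correctly S" "measured S = []" using Cons.prems by auto
  then obtain d where "\<And>\<phi>. after_step S b \<phi> = d *s \<phi>"
    using Cons.hyps unfolding measures_correctly_def by force
  then show ?case
    by (intro exI[of _ "c * d"]) (simp add: c pauli_string_PI vec_eq_iff)
qed

lemma character_commute: "character u a = character a u"
  unfolding character_def by (simp add: conj_commute)

text \<open>The map shifts by \<open>s\<close> and then applies the phases of \<open>z\<close>, that
  is, X-type followed by Z-type Pauli gates.\<close>

lemma shift_character_pauli_string:
  "\<exists>p k. cmod k = 1 \<and>
    (\<forall>\<omega>. (\<chi> a. character z a * \<omega> $ (a \<oplus> s)) = k *s (pauli_string p *v \<omega>))"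
proof -
  define p where "p q = (if s q then if z q then PY else PX else if z q then PZ else PI)" for q
  \<comment> \<open>Where both gates act, ZX = iY; this is the source of the factor
    \<open>\<i>\<close>.\<close>
  define k where "k q = (if s q \<and> z q then \<i> else 1)" for q
  have factor: "k q * pauli_mat (p q) $ a $ b = (if z q \<and> a then -1 else 1) * (if b = (a \<noteq> s q) then 1 else 0)"
    for q a b
    unfolding p_def k_def by (cases "s q"; cases "z q"; cases a; cases b) simp_all
  have "(\<Prod>q\<in>UNIV. k q) * pauli_string p $ a $ b = character z a * (if b = a \<oplus> s then 1 else 0)" for a b
    unfolding pauli_string_def vec_lambda_beta prod.distrib[symmetric] factor
    by (simp add: prod.distrib character_def prod_indicator bxor_def fun_eq_iff)
  then have "((\<Prod>q\<in>UNIV. k q) *s (pauli_string p *v \<omega>)) $ a = character z a * \<omega> $ (a \<oplus> s)" for \<omega> a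
  proof -
    assume entry: "\<And>a b. (\<Prod>q\<in>UNIV. k q) * pauli_string p $ a $ b = character z a * (if b = a \<oplus> s then 1 else 0)"
    have "((\<Prod>q\<in>UNIV. k q) *s (pauli_string p *v \<omega>)) $ a =
        (\<Sum>b\<in>UNIV. ((\<Prod>q\<in>UNIV. k q) * pauli_string p $ a $ b) * \<omega> $ b)"
      by (simp add: matrix_vector_mult_def sum_distrib_left mult.assoc)
    also have "\<dots> = (\<Sum>b\<in>UNIV. if b = a \<oplus> s then character z a * \<omega> $ (a \<oplus> s) else 0)"
      unfolding entry by (rule sum.cong) auto
    finally show ?thesis by simp
  qed
  moreover have "cmod (\<Prod>q\<in>UNIV. k q) = 1"
    unfolding prod_norm[symmetric] k_def by (rule prod.neutral) auto
  ultimately show ?thesis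
    by (intro exI[of _ p] exI[of _ "\<Prod>q\<in>UNIV. k q"]) (simp add: vec_eq_iff)
qed

definition hadamards :: "'q::finite qop" where
  "hadamards = prod_op (\<lambda>_. hadamard)"

lemma clifford_hadamards: "clifford hadamards"
  unfolding hadamards_def by (rule clifford_prod_op) (rule single_clifford_hadamard)

lemma hadamards_nth: "hadamards $ x $ y = character x y / complex_of_real (sqrt 2) ^ CARD('q)"
  for x y :: "'q::finite \<Rightarrow> bool"
  by (simp add: hadamards_def prod_op_nth hadamard_def character_def prod_dividef)

lemma cnj_hadamards_nth: "cnj (hadamards $ x $ y) = hadamards $ x $ y"
proof -
  have "cnj (character x y) = character x y"
    unfolding character_def cnj_prod by (rule prod.cong) auto
  then show ?thesis by (simp add: hadamards_nth)
qed

lemma adj_transversal_cnot_Inl_Inr: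
  "adj (transversal_cnot Inl Inr) *v \<Psi> = transversal_cnot Inl Inr *v \<Psi>"
proof -
  let ?T = "transversal_cnot Inl Inr :: ('a + 'a) qop"
  have "?T *v (?T *v \<Psi>) = \<Psi>"
    by (simp add: vec_eq_iff transversal_cnot_Inl_Inr_nth case_sum_expand_Inr_pointfree)
  moreover have "unitary ?T"
    using clifford_transversal_cnot[of Inr Inl] by (auto simp: clifford_def)
  ultimately show ?thesis
    by (metis matrix_vector_mul_assoc matrix_vector_mul_lid unitary_def)
qed

lemma diag_Inl_tensor:
  "diag (\<lambda>x. \<forall>q\<in>range Inl. x q = r q) *v tensor u v = u $ (r \<circ> Inl) *s tensor (axis (r \<circ> Inl) 1) v"
proof -
  have "(\<forall>q\<in>range Inl. x q = r q) \<longleftrightarrow> x \<circ> Inl = r \<circ> Inl" for x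
    by (auto simp: fun_eq_iff)
  then show ?thesis
    by (auto simp: vec_eq_iff diag_mult_vec_nth axis_def)
qed

text \<open>A projection of the targets between two CNOT layers is a parity projection: it forces
  the right string to be the left one plus the outcome \<open>s\<close>, so the left register now
  carries the content of \<open>\<omega>\<close>. Projecting the right register after Hadamard gates
  erases the copy there and leaves only a character as a trace.\<close>

lemma teleport:
  fixes \<xi> \<omega> :: "'n::finite ket"
  shows "diag (\<lambda>x. \<forall>q\<in>range Inr. x q = t q) *v (kron (mat 1) hadamards *v (transversal_cnot Inl Inr *v
      (diag (\<lambda>x. \<forall>q\<in>range Inr. x q = s q) *v (transversal_cnot Inl Inr *v tensor \<xi> \<omega>)))) =
    tensor (\<chi> a. hadamards $ (t \<circ> Inr) $ (a \<oplus> (s \<circ> Inr)) * \<xi> $ a * \<omega> $ (a \<oplus> (s \<circ> Inr)))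
      (axis (t \<circ> Inr) 1)"
proof -
  let ?T = "transversal_cnot Inl Inr :: ('n + 'n) qop"
  define \<theta> where "\<theta> = ?T *v (diag (\<lambda>x. \<forall>q\<in>range Inr. x q = s q) *v (?T *v tensor \<xi> \<omega>))"
  have mem: "(\<forall>q\<in>range Inr. x q = r q) \<longleftrightarrow> x \<circ> Inr = r \<circ> Inr" for x r :: "'n + 'n \<Rightarrow> bool"
    by (auto simp: fun_eq_iff)
  have shift: "b \<oplus> a = s \<circ> Inr \<longleftrightarrow> b = a \<oplus> (s \<circ> Inr)" for a b
    by (auto simp: bxor_def fun_eq_iff)
  \<comment> \<open>The second CNOT layer undoes the first on the surviving strings, so the
    amplitudes are the original ones restricted to the parity class.\<close>
  have \<theta>: "\<theta> $ case_sum a b = (if b = a \<oplus> (s \<circ> Inr) then \<xi> $ a * \<omega> $ b else 0)" for a b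
    unfolding \<theta>_def transversal_cnot_Inl_Inr_nth diag_mult_vec_nth mem
    by (simp add: shift)
  have H: "(kron (mat 1) hadamards *v \<theta>) $ z = hadamards $ (z \<circ> Inr) $ ((z \<circ> Inl) \<oplus> (s \<circ> Inr)) *
      \<xi> $ (z \<circ> Inl) * \<omega> $ ((z \<circ> Inl) \<oplus> (s \<circ> Inr))" for z
  proof -
    have "(kron (mat 1) hadamards *v \<theta>) $ z = (\<Sum>a\<in>UNIV. \<Sum>b\<in>UNIV.
        if b = a \<oplus> (s \<circ> Inr) then (if a = z \<circ> Inl then hadamards $ (z \<circ> Inr) $ (a \<oplus> (s \<circ> Inr)) *
          \<xi> $ a * \<omega> $ (a \<oplus> (s \<circ> Inr)) else 0) else 0)"
      unfolding matrix_vector_mult_def vec_lambda_beta sum_sum_assignment \<theta> kron_nth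
      by (intro sum.cong refl) (auto simp: mat_def)
    then show ?thesis by simp
  qed
  show ?thesis
    unfolding \<theta>_def[symmetric]
    by (rule ket_eqI, unfold diag_mult_vec_nth mem, simp add: H axis_def)
qed

text \<open>The Clifford \<open>U\<close> is absorbed into the measured operators of a
  teleportation. The scalar, the Pauli string and \<open>\<alpha>\<close> are chosen before
  \<open>\<psi>\<close>, so they depend on the outcomes alone; \<open>rest\<close> allows padding to
  follow.\<close>

lemma teleport_protocol:
  fixes U :: "'n::finite qop" and aux :: "'n ket" and js :: "'n list"
  defines "steps \<equiv> [conj_step (kron hadamards (mat 1)) (map Inl js),
    conj_step (transversal_cnot Inl Inr ** kron (mat 1) U) (map Inr js),
    conj_step (kron (mat 1) (hadamards ** U)) (map Inr js)]"
  assumes "clifford U" and "distinct js" and "set js = UNIV"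
    and "list_all2 (\<lambda>b S. b \<in> outcomes S) bs steps"
  shows "\<exists>c p \<alpha>. norm \<alpha> = 1 \<and> (\<forall>h rest \<psi>. \<exists>h'. run (\<lambda>_ _. PI) h (zip steps bs @ rest) (tensor aux \<psi>) =
    run (\<lambda>_ _. PI) h' rest (c *s tensor (pauli_string p *v (U *v \<psi>)) \<alpha>))"
proof -
  let ?T = "transversal_cnot Inl Inr :: ('n + 'n) qop"
  let ?W0 = "kron hadamards (mat 1) :: ('n + 'n) qop"
  let ?W1 = "?T ** kron (mat 1) U"
  let ?W2 = "kron (mat 1) (hadamards ** U) :: ('n + 'n) qop"
  have W: "clifford ?W0" "clifford ?W1" "clifford ?W2"
    using assms(2) by (auto intro!: clifford_kron clifford_mult clifford_mat_1 clifford_hadamards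
        clifford_transversal_cnot)
  obtain b0 b1 b2 where bs: "bs = [b0, b1, b2]"
    and b: "b0 \<in> outcomes (conj_step ?W0 (map Inl js))" "b1 \<in> outcomes (conj_step ?W1 (map Inr js))"
      "b2 \<in> outcomes (conj_step ?W2 (map Inr js))"
    using assms(5) unfolding steps_def list_all2_Cons2 by auto
  have js: "distinct (map Inl js)" "distinct (map Inr js)" "set (map Inl js) = range Inl"
    "set (map Inr js) = range Inr"
    using assms(3,4) by (auto simp: distinct_map)
  obtain c0 r where r: "\<And>\<phi>. after_step (conj_step ?W0 (map Inl js)) b0 \<phi> =
      c0 *s (adj ?W0 *v (diag (\<lambda>x. \<forall>q\<in>range Inl. x q = r q) *v (?W0 *v \<phi>)))"
    using after_conj_step[OF W(1) js(1) b(1)] unfolding js(3) by blast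
  obtain c1 s where s: "\<And>\<phi>. after_step (conj_step ?W1 (map Inr js)) b1 \<phi> =
      c1 *s (adj ?W1 *v (diag (\<lambda>x. \<forall>q\<in>range Inr. x q = s q) *v (?W1 *v \<phi>)))"
    using after_conj_step[OF W(2) js(2) b(2)] unfolding js(4) by blast
  obtain c2 t where t: "\<And>\<phi>. after_step (conj_step ?W2 (map Inr js)) b2 \<phi> =
      c2 *s (adj ?W2 *v (diag (\<lambda>x. \<forall>q\<in>range Inr. x q = t q) *v (?W2 *v \<phi>)))"
    using after_conj_step[OF W(3) js(2) b(3)] unfolding js(4) by blast
  define r' where "r' = r \<circ> Inl"
  define s' where "s' = s \<circ> Inr"
  define t' where "t' = t \<circ> Inr"
  \<comment> \<open>\<open>\<xi>\<close> is the X-basis state to which the first step projects the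
    auxiliary register; \<open>\<alpha>\<close> is the state in which the third step leaves the data
    register.\<close>
  define \<xi> where "\<xi> = adj hadamards *v axis r' 1"
  define \<alpha> where "\<alpha> = adj (hadamards ** U) *v axis t' 1"
  have \<xi>: "\<xi> $ a = hadamards $ r' $ a" for a
  proof -
    have "\<xi> $ a = (\<Sum>y\<in>UNIV. if y = r' then hadamards $ r' $ a else 0)"
      unfolding \<xi>_def matrix_vector_mult_def vec_lambda_beta adj_nth cnj_hadamards_nth axis_def
      by (rule sum.cong) auto
    then show ?thesis by simp
  qed
  have U: "unitary U" using assms(2) by (simp add: clifford_def)
  have "norm \<alpha> = norm (axis t' (1 :: complex))"
    unfolding \<alpha>_def using assms(2) clifford_hadamards
    by (intro norm_unitary unitary_adj unitary_mult) (auto simp: clifford_def)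
  then have \<alpha>: "norm \<alpha> = 1" by (simp add: norm_axis_1)
  \<comment> \<open>The last measurement contributes the character of t' at the shifted string, and
    \<open>\<xi>\<close> that of r'. Up to a constant their product is the character of the sum of
    t' and r', so a phase and a shift remain: a Pauli operator.\<close>
  obtain p k where p: "\<And>\<omega>. (\<chi> a. character (t' \<oplus> r') a * \<omega> $ (a \<oplus> s')) = k *s (pauli_string p *v \<omega>)"
    using shift_character_pauli_string by blast
  let ?N = "complex_of_real (sqrt 2) ^ CARD('n)"
  define \<kappa> where "\<kappa> = character t' s' / (?N * ?N) * k"
  have \<eta>: "(\<chi> a. hadamards $ t' $ (a \<oplus> s') * \<xi> $ a * \<omega> $ (a \<oplus> s')) = \<kappa> *s (pauli_string p *v \<omega>)" for \<omega>
  proof -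
    have "(\<chi> a. hadamards $ t' $ (a \<oplus> s') * \<xi> $ a * \<omega> $ (a \<oplus> s')) =
        (character t' s' / (?N * ?N)) *s (\<chi> a. character (t' \<oplus> r') a * \<omega> $ (a \<oplus> s'))"
      by (simp add: vec_eq_iff \<xi> hadamards_nth character_bxor character_commute[of "t' \<oplus> r'"])
        (simp add: character_commute)
    then show ?thesis by (simp add: p \<kappa>_def vec_eq_iff)
  qed
  \<comment> \<open>The factor \<open>(hadamards *v aux) $ r'\<close> is the amplitude of the first
    outcome in \<open>aux\<close>. It may vanish, in which case the outcome sequence has probability
    zero.\<close>
  let ?c = "c0 * (hadamards *v aux) $ r' * c1 * c2 * \<kappa>"
  have smult: "A *v (c *s v) = c *s (A *v v)" for A :: "('n + 'n) qop" and c v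
    by (rule vector_scalar_commute)
  have "after_step (conj_step ?W2 (map Inr js)) b2 (after_step (conj_step ?W1 (map Inr js)) b1
      (after_step (conj_step ?W0 (map Inl js)) b0 (tensor aux \<psi>))) =
      ?c *s tensor (pauli_string p *v (U *v \<psi>)) \<alpha>" for \<psi>
  proof -
    have step0: "after_step (conj_step ?W0 (map Inl js)) b0 (tensor aux \<psi>) =
        (c0 * (hadamards *v aux) $ r') *s tensor \<xi> \<psi>"
      by (simp only: r kron_mult_vec diag_Inl_tensor smult adj_kron \<xi>_def r'_def vector_smult_assoc
          matrix_vector_mul_lid adj_mat_1)
    \<comment> \<open>Between the second and the third projection, \<open>U\<close> and its adjoint
      cancel; what remains is the circuit of \<open>teleport\<close>.\<close>
    have "?W2 *v (adj ?W1 *v \<Psi>) = kron (mat 1) hadamards *v (?T *v \<Psi>)" for \<Psi>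
    proof -
      have "hadamards ** U ** adj U = hadamards"
        using U by (simp add: unitary_def flip: matrix_mul_assoc)
      then have "?W2 ** adj ?W1 = kron (mat 1) hadamards ** adj ?T"
        by (simp add: adj_mult adj_kron matrix_mul_assoc kron_mult)
      then have "?W2 *v (adj ?W1 *v \<Psi>) = kron (mat 1) hadamards *v (adj ?T *v \<Psi>)"
        by (simp only: matrix_vector_mul_assoc)
      then show ?thesis by (simp only: adj_transversal_cnot_Inl_Inr)
    qed
    moreover have "?W1 *v tensor \<xi> \<psi> = ?T *v tensor \<xi> (U *v \<psi>)"
      by (simp add: kron_mult_vec flip: matrix_vector_mul_assoc)
    ultimately have "diag (\<lambda>x. \<forall>q\<in>range Inr. x q = t q) *v (?W2 *v (adj ?W1 *v
        (diag (\<lambda>x. \<forall>q\<in>range Inr. x q = s q) *v (?W1 *v tensor \<xi> \<psi>)))) =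
        tensor (\<kappa> *s (pauli_string p *v (U *v \<psi>))) (axis t' 1)"
      using teleport[of t s \<xi> "U *v \<psi>"] by (simp add: \<eta> flip: s'_def t'_def)
    then have "adj ?W2 *v (diag (\<lambda>x. \<forall>q\<in>range Inr. x q = t q) *v (?W2 *v (adj ?W1 *v
        (diag (\<lambda>x. \<forall>q\<in>range Inr. x q = s q) *v (?W1 *v tensor \<xi> \<psi>))))) =
        tensor (\<kappa> *s (pauli_string p *v (U *v \<psi>))) \<alpha>"
      by (simp add: adj_kron kron_mult_vec \<alpha>_def)
    moreover have "tensor (\<kappa> *s u) v = \<kappa> *s tensor u v" for u v :: "'n ket"
      by (simp add: vec_eq_iff)
    ultimately show ?thesis
      unfolding step0 s t smult by (simp add: vector_smult_assoc mult_ac)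
  qed
  then have "\<exists>h'. run (\<lambda>_ _. PI) h (zip steps bs @ rest) (tensor aux \<psi>) =
      run (\<lambda>_ _. PI) h' rest (?c *s tensor (pauli_string p *v (U *v \<psi>)) \<alpha>)" for h rest \<psi>
    by (simp add: steps_def bs pauli_string_PI del: after_step.simps) blast
  with \<alpha> show ?thesis by blast
qed

theorem theorem3:
  fixes U :: "'n::finite qop" and aux :: "'n ket"
  assumes "clifford_circuit U"
    and "aux = z_ket (\<lambda>_. False) \<or> aux = x_ket (\<lambda>_. False)"
  shows "\<exists>(steps :: ('n + 'n) step list) corr.
    length steps = 22 \<and>
    (\<forall>S\<in>set steps. pauli_measurement_step S) \<and>
    length (filter uses_two_blocks steps) = 5 \<and>
    length (filter uses_one_block steps) = 8 \<and>
    implements_up_to_permutation aux steps corr U"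
proof -
  have U: "clifford U" using assms(1) by (rule clifford_circuit_imp_clifford)
  obtain js :: "'n list" where js: "distinct js" "set js = UNIV"
    using finite_distinct_list[of "UNIV :: 'n set"] by auto
  define main where "main = [conj_step (kron hadamards (mat 1)) (map Inl js),
    conj_step (transversal_cnot Inl Inr ** kron (mat 1) U) (map Inr js),
    conj_step (kron (mat 1) (hadamards ** U)) (map Inr js)]"
  \<comment> \<open>Counts: 3 + 2 = 5 two-block steps and 8 one-block steps, and 9 direct steps
    bring the total to 22.\<close>
  define pad :: "('n + 'n) step list" where "pad = replicate 2 (conj_step (mat 1) []) @
    replicate 8 (First_Block [] (z_ket (\<lambda>_. False))) @ replicate 9 (Direct [])"
  let ?corr = "\<lambda>_ _. PI"
  have "\<forall>S\<in>set main. pauli_measurement_step S"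
    using U by (auto simp: main_def intro!: pauli_measurement_step_conj_step clifford_kron clifford_mult
        clifford_mat_1 clifford_hadamards clifford_transversal_cnot)
  moreover have pad: "\<forall>S\<in>set pad. pauli_measurement_step S \<and> measured S = []"
    by (auto simp: pad_def conj_step_def[of _ "[]"] First_Block_trivial Direct_trivial
        pauli_measurement_step_conj_step[OF clifford_mat_1, of "[]", unfolded conj_step_def, simplified])
  moreover have "length (main @ pad) = 22" "length (filter uses_two_blocks (main @ pad)) = 5"
    "length (filter uses_one_block (main @ pad)) = 8"
    by (simp_all add: main_def pad_def conj_step_def)
  moreover have "implements_up_to_permutation aux (main @ pad) ?corr U"
    unfolding implements_up_to_permutation_def
  \<comment> \<open>Teleportation leaves the output on the auxiliary half, so the permutation
    exchanges the two halves.\<close>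
  proof (intro exI[of _ "case_sum Inr Inl"] conjI allI impI)
    show "bij (case_sum Inr Inl :: 'n + 'n \<Rightarrow> 'n + 'n)"
      by (rule involuntory_imp_bij) (auto split: sum.splits)
  next
    fix bs assume "list_all2 (\<lambda>b S. b \<in> outcomes S) bs (main @ pad)"
    then obtain bs1 bs2 where bs: "bs = bs1 @ bs2" and bs1: "list_all2 (\<lambda>b S. b \<in> outcomes S) bs1 main"
      and bs2: "list_all2 (\<lambda>b S. b \<in> outcomes S) bs2 pad"
      by (auto simp: list_all2_append2)
    have zip: "zip (main @ pad) bs = zip main bs1 @ zip pad bs2"
      using list_all2_lengthD[OF bs1] by (simp add: bs)
    obtain c p \<alpha> where \<alpha>: "norm \<alpha> = 1" and main: "\<And>h rest \<psi>. \<exists>h'. run ?corr h (zip main bs1 @ rest) (tensor aux \<psi>) =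
        run ?corr h' rest (c *s tensor (pauli_string p *v (U *v \<psi>)) \<alpha>)"
      using teleport_protocol[OF U js, of bs1 aux] bs1 unfolding main_def by blast
    obtain d where "\<And>h \<phi>. run ?corr h (zip pad bs2) \<phi> = d *s \<phi>"
      using run_trivial_steps[OF bs2] pad unfolding pauli_measurement_step_def by blast
    then have run: "run ?corr [] (zip (main @ pad) bs) (tensor aux \<psi>) =
        (d * c) *s tensor (pauli_string p *v (U *v \<psi>)) \<alpha>" for \<psi>
      using main[of "[]" "zip pad bs2" \<psi>] by (auto simp: zip vector_smult_assoc)
    show "\<exists>\<alpha> E. norm \<alpha> = 1 \<and> (\<forall>\<psi>. norm \<psi> = 1 \<longrightarrow>
        (let \<phi> = run ?corr [] (zip (main @ pad) bs) (tensor aux \<psi>) in \<phi> \<noteq> 0 \<longrightarrow>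
          (\<exists>c. cmod c = 1 \<and> permute_qubits (case_sum Inr Inl) ((1 / norm \<phi>) *\<^sub>R \<phi>) =
            c *s tensor \<alpha> (pauli_string E *v (U *v \<psi>)))))"
      unfolding Let_def run
    proof (intro exI[of _ \<alpha>] exI[of _ p] conjI allI impI \<alpha>)
      fix \<psi> :: "'n ket"
      let ?\<omega> = "pauli_string p *v (U *v \<psi>)"
      assume "norm \<psi> = 1" and nonzero: "(d * c) *s tensor ?\<omega> \<alpha> \<noteq> 0"
      have "norm ?\<omega> = 1"
        using U \<open>norm \<psi> = 1\<close> by (simp add: norm_unitary unitary_pauli_string clifford_def)
      then have "norm ((d * c) *s tensor ?\<omega> \<alpha>) = cmod (d * c)"
        by (simp add: norm_smult norm_tensor \<alpha>)
      moreover have "d * c \<noteq> 0" using nonzero by auto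
      \<comment> \<open>Since \<open>tensor ?\<omega> \<alpha>\<close> has norm 1, normalisation
        divides by the modulus of \<open>d * c\<close>, and the global phase is the quotient of
        \<open>d * c\<close> by it.\<close>
      ultimately show "\<exists>e. cmod e = 1 \<and> permute_qubits (case_sum Inr Inl)
          ((1 / norm ((d * c) *s tensor ?\<omega> \<alpha>)) *\<^sub>R ((d * c) *s tensor ?\<omega> \<alpha>)) = e *s tensor \<alpha> ?\<omega>"
        by (intro exI[of _ "(d * c) / cmod (d * c)"])
          (auto simp: vec_eq_iff permute_qubits_def norm_divide comp_def scaleR_conv_of_real[of _ z for z :: complex])
    qed
  qed
  ultimately show ?thesis
    by (intro exI[of _ "main @ pad"] exI[of _ ?corr]) auto
qed

end
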